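(* Consider the randomized gossip algorithm with unreliable communication on $n\ge 3$ nodes, with node pair selection matrix $A=[a_{ij}]$ and communication probabilities $\{P_k^+\}_{k\ge0},\{P_k^-\}_{k\ge0}$ (as defined in the context). Suppose that communication is independent, i.e. the events $\mathbb{E}_k^+$ and $\mathbb{E}_k^-$ are independent for all $k$, and that both the underlying digraph $\mathcal{G}_0$ and its converse graph $\mathcal{G}_0^T$ are quasi-strongly connected. Then global a.s. $\epsilon$-consensus is achieved if and only if there exist a constant $p_\ast>0$ and an integer $T_\ast\ge1$ such that $\sum_{k=m}^{m+T_\ast-1}(P_k^++P_k^-)\ge p_\ast$ for all $m\ge0$. In this case, $$T_{\rm com}(\epsilon)\le\frac{4T_\ast\theta_0/p_\ast}{\log\big(1-\big(\frac{a_\ast}{4n}\big)^{\theta_0}\big)^{-1}}\log\epsilon^{-1}+O(1),$$ where $\theta_0=(2d_\ast-1)(2E_\ast-1)$.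
   Context: Network model. The node set is $\mathcal{V}=\{1,\dots,n\}$, $n\ge3$. $A=[a_{ij}]\in\mathbb{R}^{n\times n}$ is a stochastic matrix (nonnegative entries, each row sums to $1$). The underlying digraph is $\mathcal{G}_0=(\mathcal{V},\mathcal{E}_0)$ with $(j,i)\in\mathcal{E}_0$ if and only if $a_{ij}>0$. Its converse graph $\mathcal{G}_0^T$ is obtained by reversing all arcs. A digraph is quasi-strongly connected if it has a center, i.e. a node from which every other node is reachable by a directed path. Constants. For a nonnegative matrix $P=[p_{ij}]$, the induced graph $\mathcal{G}_P$ on $\{1,\dots,n\}$ has arc $(j,i)$ iff $p_{ij}>0$; thus $\mathcal{G}_A=\mathcal{G}_0$ and $\mathcal{G}_{A^T}=\mathcal{G}_0^T$. The diameter of a digraph is the maximum of the distances $d(i,j)$ (length of a shortest directed path from $i$ to $j$) over all pairs $i,j$ with $j$ reachable from $i$. Set $d_\ast=\max\{\mathrm{diam}(\mathcal{G}_A),\mathrm{diam}(\mathcal{G}_{A^T})\}$, $E_\ast=|\mathcal{E}_0|-\sum_{i=1}^n\mathrm{sgn}(a_{ii})$ (the number of arcs that are not self-loops), and $a_\ast=\min\{a_{ij}: a_{ij}>0,\ i\ne j\}$. Node pair selection process. Independently at each time $k=0,1,2,\dots$, a node $i\in\mathcal{V}$ is drawn with probability $1/n$, and then node $i$ picks the (ordered) pair $(i,j)$ with probability $a_{ij}$. Node communication process. $\{P_k^+\}_{k\ge0}$ and $\{P_k^-\}_{k\ge0}$ are deterministic sequences in $[0,1]$. Independently over time, and independently of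 the node states and of the node pair selection process, $\mathbf{P}(\mathbb{E}_k^+)=P_k^+$ and $\mathbf{P}(\mathbb{E}_k^-)=P_k^-$, where $\mathbb{E}_k^+$ is the event that node $i$ receives $x_j(k)$ when $(i,j)$ is selected at time $k$, and $\mathbb{E}_k^-$ is the event that node $j$ receives $x_i(k)$ when $(i,j)$ is selected at time $k$. Algorithm. Let $k_0\ge0$ be an arbitrary integer initial time and $x(k_0)=x^0\in\mathbb{R}^n$ a deterministic initial condition. For $k\ge k_0$, $x_i(k+1)=\frac12x_i(k)+\frac12x_j(k)$ if $(i,j)$ or $(j,i)$ is selected at time $k$ and $i$ receives $x_j(k)$; otherwise $x_i(k+1)=x_i(k)$. $\epsilon$-consensus. Let $\mathcal{H}(k)=\max_i x_i(k)-\min_i x_i(k)$. The $\epsilon$-computation time is $$T_{\rm com}(\epsilon)=\sup_{k_0,\,x(k_0)}\inf\Big\{k-k_0:\ \mathbf{P}\Big(\frac{\mathcal{H}(k)}{\mathcal{H}(k_0)}\ge\epsilon\Big)\le\epsilon\Big\},$$ the supremum being over integers $k_0\ge0$ and initial conditions $x(k_0)\in\mathbb{R}^n$ with $\mathcal{H}(k_0)>0$. Global a.s. $\epsilon$-consensus is achieved if $T_{\rm com}(\epsilon)=O(\log\epsilon^{-1})$, where by definition $f(\epsilon)=O(g(\epsilon))$ means that $\limsup_{\epsilon\to0}f(\epsilon)/g(\epsilon)<\infty$ is a nonzero constant. In the displayed bound, $O(1)$ denotes a term that stays bounded as $\epsilon\to0$. *)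

theory Defs
  imports "HOL-Probability.Probability" "HOL-Library.Landau_Symbols"
begin

section \<open>Digraphs\<close>

text \<open>A digraph is its set of arcs; the node set is the whole finite type of node labels,
  so \<^term>\<open>CARD('n)\<close> is the number of nodes. The converse digraph is
  \<^term>\<open>E\<inverse>\<close>.\<close>

definition induced_graph :: "real^'n^'n \<Rightarrow> ('n \<times> 'n) set" where
  "induced_graph P = {(j, i). P $ i $ j > 0}"

definition quasi_strongly_connected :: "('n \<times> 'n) set \<Rightarrow> bool" where
  "quasi_strongly_connected E \<longleftrightarrow> (\<exists>c. \<forall>v. v \<noteq> c \<longrightarrow> (c, v) \<in> E\<^sup>*)"

text \<open>Only meaningful when \<open>j\<close> is reachable from \<open>i\<close>. A shortest walk is a path,
  so walks of length \<open>m\<close> suffice here.\<close>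

definition digraph_dist :: "('n \<times> 'n) set \<Rightarrow> 'n \<Rightarrow> 'n \<Rightarrow> nat" where
  "digraph_dist E i j = (LEAST m. (i, j) \<in> E ^^ m)"

definition diam :: "('n::finite \<times> 'n) set \<Rightarrow> nat" where
  "diam E = Max {digraph_dist E i j | i j. (i, j) \<in> E\<^sup>*}"

section \<open>Constants of the selection matrix\<close>

definition d_star :: "real^'n::finite^'n \<Rightarrow> nat" where
  "d_star A = max (diam (induced_graph A)) (diam (induced_graph (transpose A)))"

definition E_star :: "real^'n::finite^'n \<Rightarrow> real" where
  "E_star A = real (card (induced_graph A)) - (\<Sum>i\<in>UNIV. sgn (A $ i $ i))"

definition a_star :: "real^'n::finite^'n \<Rightarrow> real" where
  "a_star A = Min {A $ i $ j | i j. A $ i $ j > 0 \<and> i \<noteq> j}"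

definition theta0 :: "real^'n::finite^'n \<Rightarrow> real" where
  "theta0 A = (2 * real (d_star A) - 1) * (2 * E_star A - 1)"

section \<open>The random network\<close>

text \<open>\<open>sel k\<close> is the ordered pair selected at time \<open>k\<close>: its first component is drawn
  uniformly, and given that it is \<open>i\<close>, the second is \<open>j\<close> with probability \<open>A $ i $ j\<close>.
  \<open>Ep k\<close> (\<open>Em k\<close>) is the event that the first (second) node of the pair receives the
  state of the other one. Within one time step \<open>Ep k\<close> and \<open>Em k\<close> may depend on each other.
  The last assumption makes the two whole processes independent: the \<open>\<sigma>\<close>-algebras they
  generate are independent. Node states, being functions of the past of both processes, are
  then independent of the current selection and communication.\<close>

locale gossip_network = prob_space M
  for M :: "'w measure" +
  fixes A :: "real^'n::finite^'n"
    and Pp Pm :: "nat \<Rightarrow> real"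
    and sel :: "nat \<Rightarrow> 'w \<Rightarrow> 'n \<times> 'n"
    and Ep Em :: "nat \<Rightarrow> 'w set"
  assumes A_nonneg: "A $ i $ j \<ge> 0"
    and A_row_sum: "(\<Sum>j\<in>UNIV. A $ i $ j) = 1"
    and Pp_range: "Pp k \<in> {0..1}"
    and Pm_range: "Pm k \<in> {0..1}"
    and sel_prob: "prob {\<omega> \<in> space M. sel k \<omega> = (i, j)} = 1 / real CARD('n) * A $ i $ j"
    and sel_indep: "indep_vars (\<lambda>_. count_space UNIV) sel UNIV"
    and Ep_event: "Ep k \<in> events"
    and Em_event: "Em k \<in> events"
    and Ep_prob: "prob (Ep k) = Pp k"
    and Em_prob: "prob (Em k) = Pm k"
    and comm_indep:
      "indep_vars (\<lambda>_. count_space UNIV) (\<lambda>k \<omega>. (\<omega> \<in> Ep k, \<omega> \<in> Em k)) UNIV"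
    and sel_comm_indep:
      "indep_set
        (sets (vimage_algebra (space M) (\<lambda>\<omega> k. sel k \<omega>)
                (Pi\<^sub>M UNIV (\<lambda>_. count_space UNIV))))
        (sets (vimage_algebra (space M) (\<lambda>\<omega> k. (\<omega> \<in> Ep k, \<omega> \<in> Em k))
                (Pi\<^sub>M UNIV (\<lambda>_. count_space UNIV))))"

section \<open>The algorithm\<close>

definition gossip_step :: "'n \<times> 'n \<Rightarrow> bool \<Rightarrow> bool \<Rightarrow> real^'n::finite \<Rightarrow> real^'n" where
  "gossip_step p rp rm x =
    (\<chi> l. if l = fst p \<and> rp then x $ l / 2 + x $ snd p / 2
         else if l = snd p \<and> rm then x $ l / 2 + x $ fst p / 2
         else x $ l)"

text \<open>The state \<open>x(k)\<close> started from \<open>x0\<close> at time \<open>k0\<close>; it is set to \<open>x0\<close> also for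
  \<open>k < k0\<close>, where it is never used.\<close>

primrec gossip_state ::
  "(nat \<Rightarrow> 'w \<Rightarrow> 'n \<times> 'n) \<Rightarrow> (nat \<Rightarrow> 'w set) \<Rightarrow> (nat \<Rightarrow> 'w set) \<Rightarrow>
    nat \<Rightarrow> real^'n::finite \<Rightarrow> nat \<Rightarrow> 'w \<Rightarrow> real^'n" where
  "gossip_state sel Ep Em k0 x0 0 \<omega> = x0"
| "gossip_state sel Ep Em k0 x0 (Suc k) \<omega> =
    (if k < k0 then x0
     else gossip_step (sel k \<omega>) (\<omega> \<in> Ep k) (\<omega> \<in> Em k) (gossip_state sel Ep Em k0 x0 k \<omega>))"

definition spread :: "real^'n::finite \<Rightarrow> real" where
  "spread x = Max (range (\<lambda>i. x $ i)) - Min (range (\<lambda>i. x $ i))"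

section \<open>Computation time and consensus\<close>

text \<open>Extended real valued; the infimum over the empty set is \<open>\<infinity>\<close>.\<close>

definition T_com ::
  "'w measure \<Rightarrow> (nat \<Rightarrow> 'w \<Rightarrow> 'n::finite \<times> 'n) \<Rightarrow> (nat \<Rightarrow> 'w set) \<Rightarrow> (nat \<Rightarrow> 'w set) \<Rightarrow>
    real \<Rightarrow> ereal" where
  "T_com M sel Ep Em \<epsilon> =
    (SUP (k0, x0) \<in> {(k0 :: nat, x0 :: real^'n). spread x0 > 0}.
      INF k \<in> {k. k \<ge> k0 \<and>
          measure M {\<omega> \<in> space M.
            spread (gossip_state sel Ep Em k0 x0 k \<omega>) / spread x0 \<ge> \<epsilon>} \<le> \<epsilon>}.
        ereal (real (k - k0)))"

text \<open>The meaning of \<open>f(\<epsilon>) = O(g(\<epsilon>))\<close> in the definition of consensus. Unlike the Landau symbol of the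
  library it also excludes the value \<open>0\<close>: the limit superior of \<open>f(\<epsilon>) / g(\<epsilon>)\<close> as \<open>\<epsilon>\<close> tends to \<open>0\<close> from above must be finite and nonzero.\<close>

definition exact_order_at_0 :: "(real \<Rightarrow> ereal) \<Rightarrow> (real \<Rightarrow> real) \<Rightarrow> bool" where
  "exact_order_at_0 f g \<longleftrightarrow>
    (\<exists>c::real. c \<noteq> 0 \<and> Limsup (at_right 0) (\<lambda>\<epsilon>. f \<epsilon> / ereal (g \<epsilon>)) = ereal c)"

definition global_as_eps_consensus ::
  "'w measure \<Rightarrow> (nat \<Rightarrow> 'w \<Rightarrow> 'n::finite \<times> 'n) \<Rightarrow> (nat \<Rightarrow> 'w set) \<Rightarrow> (nat \<Rightarrow> 'w set) \<Rightarrow>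
    bool" where
  "global_as_eps_consensus M sel Ep Em \<longleftrightarrow>
    exact_order_at_0 (T_com M sel Ep Em) (\<lambda>\<epsilon>. ln (1 / \<epsilon>))"

end

theory Submission
  imports Defs
begin

text \<open>Let \<open>D\<^sub>k(u, v)\<close> be the expectation of \<open>\<bar>x\<^sub>u(k) - x\<^sub>v(k)\<bar>\<close>. One step bounds \<open>D\<^sub>k\<^sub>+\<^sub>1(u, v)\<close> by an average of
  \<open>D\<^sub>k(u, v)\<close>, with weight at least \<open>2 powr - (P\<^sup>+ + P\<^sup>-)\<close>, and of other entries of \<open>D\<^sub>k\<close>; the
  entry \<open>D\<^sub>k(w, v)\<close> enters with weight at least \<open>(a\<^sub>*/2n) P\<^sup>+\<close> for an arc \<open>(w, u)\<close> of the digraph and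
  \<open>(a\<^sub>*/2n) P\<^sup>-\<close> for an arc of its converse. In a block of time with total communication weight
  between \<open>8 d\<^sub>*\<close> and \<open>8 d\<^sub>* + 2\<close>, one of the two kinds has weight at least \<open>4 d\<^sub>*\<close>. This suffices to
  transport the value \<open>D(c, c) = 0\<close> at the corresponding center \<open>c\<close> along at most \<open>2 d\<^sub>*\<close> arcs to every
  pair, so the maximum of \<open>D\<close> contracts, and Markov's inequality bounds the computation time. The
  constant is good enough because \<open>\<theta>\<^sub>0 \<ge> 4 d\<^sub>* + 1\<close>.

  The computation time is at least of order \<open>log(1/\<epsilon>)\<close> because some node stays out of the
  selected pairs with probability at least \<open>1/3\<close> per step.\<close>

section \<open>Constants of the digraph\<close>

lemma rtrancl_in_arc:
  assumes "(c, v) \<in> E\<^sup>*" "c \<noteq> v"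
  shows "\<exists>w. w \<noteq> v \<and> (w, v) \<in> E"
  using assms
proof (induction rule: rtrancl_induct)
  case (step y z)
  then show ?case by (cases "y = z") auto
qed simp

lemma relpow_digraph_dist: "(i, j) \<in> E\<^sup>* \<Longrightarrow> (i, j) \<in> E ^^ digraph_dist E i j"
  unfolding digraph_dist_def by (rule LeastI_ex) (simp add: rtrancl_power)

lemma digraph_dist_le_diam:
  fixes E :: "('n::finite \<times> 'n) set"
  assumes "(i, j) \<in> E\<^sup>*"
  shows "digraph_dist E i j \<le> diam E"
proof -
  have "{digraph_dist E i j | i j. (i, j) \<in> E\<^sup>*} \<subseteq> (\<lambda>(i, j). digraph_dist E i j) ` UNIV"
    by auto
  then have "finite {digraph_dist E i j | i j. (i, j) \<in> E\<^sup>*}"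
    by (rule finite_subset) simp
  then show ?thesis
    unfolding diam_def using assms by (intro Max_ge) auto
qed

lemma induced_graph_transpose: "induced_graph (transpose A) = (induced_graph A)\<inverse>"
  by (auto simp: induced_graph_def transpose_def)

lemma E_star_eq_card:
  fixes A :: "real^'n::finite^'n"
  assumes "\<And>i j. A $ i $ j \<ge> 0"
  shows "E_star A = real (card (induced_graph A - Id))"
proof -
  let ?G = "induced_graph A"
  have "sgn (A $ i $ i) = (if (i, i) \<in> ?G then 1 else 0)" for i
    using assms[of i i] by (auto simp: induced_graph_def sgn_real_def)
  then have "(\<Sum>i\<in>UNIV. sgn (A $ i $ i)) = real (card {i. (i, i) \<in> ?G})"
    by (simp add: sum.If_cases)
  also have "card {i. (i, i) \<in> ?G} = card (?G \<inter> Id)"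
    by (rule bij_betw_same_card[of "\<lambda>i. (i, i)"]) (auto simp: bij_betw_def inj_on_def)
  finally show ?thesis
    unfolding E_star_def using card_Diff_subset_Int[of ?G Id] card_mono[of ?G "?G \<inter> Id"]
    by (simp add: of_nat_diff)
qed

lemma ex_two_others:
  assumes "CARD('n::finite) \<ge> 3"
  shows "\<exists>v w. v \<noteq> (c::'n) \<and> w \<noteq> c \<and> v \<noteq> w"
proof -
  have "card (UNIV - {c}) \<ge> 2"
    using assms by simp
  then obtain S where S: "S \<subseteq> UNIV - {c}" "card S = 2"
    by (meson obtain_subset_with_card_n)
  then show ?thesis by (auto simp: card_2_iff)
qed

lemma ex_other:
  assumes "CARD('n::finite) \<ge> 3"
  shows "\<exists>v. v \<noteq> (c::'n) \<and> v \<noteq> d"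
  using ex_two_others[OF assms, of c] by metis

lemma a_star_le:
  fixes A :: "real^'n::finite^'n"
  assumes "A $ i $ j > 0" "i \<noteq> j"
  shows "a_star A \<le> A $ i $ j"
proof -
  have "{A $ i $ j | i j. A $ i $ j > 0 \<and> i \<noteq> j} \<subseteq> (\<lambda>(i, j). A $ i $ j) ` UNIV"
    by auto
  then have "finite {A $ i $ j | i j. A $ i $ j > 0 \<and> i \<noteq> j}"
    by (rule finite_subset) simp
  then show ?thesis
    unfolding a_star_def using assms by (intro Min_le) auto
qed

section \<open>Lower bounds for the graph constants\<close>

context
  fixes A :: "real^'n::finite^'n"
  assumes nonneg: "\<And>i j. A $ i $ j \<ge> 0"
    and card: "CARD('n) \<ge> 3"
    and center: "quasi_strongly_connected (induced_graph A)"
    and anticenter: "quasi_strongly_connected ((induced_graph A)\<inverse>)"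
begin

lemma d_star_ge_1: "d_star A \<ge> 1"
proof -
  obtain c where c: "\<And>v. v \<noteq> c \<Longrightarrow> (c, v) \<in> (induced_graph A)\<^sup>*"
    using center by (auto simp: quasi_strongly_connected_def)
  obtain v where v: "v \<noteq> c"
    using ex_two_others[OF card, of c] by auto
  have "digraph_dist (induced_graph A) c v \<noteq> 0"
    using relpow_digraph_dist[OF c[OF v]] v by (metis pair_in_Id_conv relpow.simps(1))
  then show ?thesis
    using digraph_dist_le_diam[OF c[OF v]] by (auto simp: d_star_def)
qed

text \<open>Two nodes other than the center each receive an arc from another node, and arcs with
  different heads differ.\<close>

lemma E_star_ge_2: "E_star A \<ge> 2"
proof -
  let ?G = "induced_graph A"
  obtain c where c: "\<And>v. v \<noteq> c \<Longrightarrow> (c, v) \<in> ?G\<^sup>*"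
    using center by (auto simp: quasi_strongly_connected_def)
  obtain v w where vw: "v \<noteq> c" "w \<noteq> c" "v \<noteq> w"
    using ex_two_others[OF card, of c] by auto
  obtain v' w' where "v' \<noteq> v" "(v', v) \<in> ?G" "w' \<noteq> w" "(w', w) \<in> ?G"
    using rtrancl_in_arc[OF c[OF vw(1)]] rtrancl_in_arc[OF c[OF vw(2)]] vw by blast
  then have "{(v', v), (w', w)} \<subseteq> ?G - Id" "card {(v', v), (w', w)} = 2"
    using vw by auto
  then have "2 \<le> card (?G - Id)"
    using card_mono[of "?G - Id" "{(v', v), (w', w)}"] by simp
  then show ?thesis
    using E_star_eq_card[OF nonneg] by simp
qed

text \<open>When distances are at most 1, the center \<open>c\<close> has an arc to every other
  node, and every other node has one to the center \<open>s\<close> of the converse. This yields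
  three arcs whether or not \<open>c = s\<close>; two would be too few for
  \<open>theta0_ge\<close>.\<close>

lemma E_star_ge_3_if_d_star_1:
  assumes d1: "d_star A = 1"
  shows "E_star A \<ge> 3"
proof -
  let ?G = "induced_graph A"
  obtain c where c: "\<And>v. v \<noteq> c \<Longrightarrow> (c, v) \<in> ?G\<^sup>*"
    using center by (auto simp: quasi_strongly_connected_def)
  obtain s where s: "\<And>v. v \<noteq> s \<Longrightarrow> (s, v) \<in> (?G\<inverse>)\<^sup>*"
    using anticenter by (auto simp: quasi_strongly_connected_def)
  have one: "(i, j) \<in> H" if "H = ?G \<or> H = ?G\<inverse>" "(i, j) \<in> H\<^sup>*" "i \<noteq> j" for H i j
  proof -
    have "digraph_dist H i j \<le> 1"
      using digraph_dist_le_diam[OF that(2)] that(1) d1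
      by (auto simp: d_star_def induced_graph_transpose)
    with relpow_digraph_dist[OF that(2)] that(3) show ?thesis
      by (cases "digraph_dist H i j") auto
  qed
  have cv: "(c, v) \<in> ?G" if "v \<noteq> c" for v
    using one[of ?G c v] c that by auto
  have vs: "(v, s) \<in> ?G" if "v \<noteq> s" for v
    using one[of "?G\<inverse>" s v] s that by auto
  have "\<exists>X. X \<subseteq> ?G - Id \<and> card X = 3"
  proof (cases "c = s")
    case True
    obtain v w where vw: "v \<noteq> c" "w \<noteq> c" "v \<noteq> w"
      using ex_two_others[OF card, of c] by auto
    then show ?thesis
      using cv vs True by (intro exI[of _ "{(c, v), (c, w), (v, c)}"]) auto
  next
    case False
    obtain v where "v \<noteq> c" "v \<noteq> s"
      using ex_other[OF card, of c s] by auto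
    then show ?thesis
      using cv vs False by (intro exI[of _ "{(c, v), (c, s), (v, s)}"]) auto
  qed
  then obtain X where "X \<subseteq> ?G - Id" "card X = 3"
    by blast
  then have "3 \<le> card (?G - Id)"
    using card_mono[of "?G - Id" X] by simp
  then show ?thesis
    using E_star_eq_card[OF nonneg] by simp
qed

text \<open>For \<open>d_star A = 1\<close> three arcs give at least 5. Otherwise two arcs give 3 (2
  d - 1), which is at least 4 d + 1 from d = 2 on.\<close>

lemma theta0_ge: "theta0 A \<ge> 4 * real (d_star A) + 1"
proof (cases "d_star A = 1")
  case True
  then show ?thesis
    using E_star_ge_3_if_d_star_1 by (simp add: theta0_def)
next
  case False
  then have d: "real (d_star A) \<ge> 2"
    using d_star_ge_1 by linarith
  have "(2 * real (d_star A) - 1) * 3 \<le> (2 * real (d_star A) - 1) * (2 * E_star A - 1)"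
    using E_star_ge_2 d by (intro mult_left_mono) auto
  then show ?thesis
    using d by (simp add: theta0_def)
qed

lemma a_star_attained: "\<exists>i j. A $ i $ j > 0 \<and> i \<noteq> j \<and> a_star A = A $ i $ j"
proof -
  let ?S = "{A $ i $ j | i j. A $ i $ j > 0 \<and> i \<noteq> j}"
  have "?S \<subseteq> (\<lambda>(i, j). A $ i $ j) ` UNIV"
    by auto
  then have "finite ?S"
    by (rule finite_subset) simp
  moreover have "?S \<noteq> {}"
  proof -
    have "card (induced_graph A - Id) \<noteq> 0"
      using E_star_ge_2 E_star_eq_card[OF nonneg] by linarith
    then obtain e where "e \<in> induced_graph A - Id"
      by (metis card.empty ex_in_conv)
    then show ?thesis
      by (cases e) (auto simp: induced_graph_def)
  qed
  ultimately have "Min ?S \<in> ?S"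
    by (rule Min_in)
  then show ?thesis
    unfolding a_star_def by auto
qed

end

text \<open>Compares the constant of the stated bound with the gain of one block. With y = a/(4n), 2
  d factors y give the arc weights times 2^(-2 d); the other 2 d + 1 factors, each at most 1/8,
  supply the missing 2^(-(6 d + 2)).\<close>

lemma block_loss_ge:
  fixes a t :: real
  assumes a: "0 < a" "a \<le> 1" and n: "n \<ge> (3::real)" and t: "t \<ge> 4 * real d + 1"
  shows "(a / (4 * n)) powr t \<le> (a / (2 * n)) ^ (2 * d) / 2 ^ (8 * d + 2)"
proof -
  define y where "y = a / (4 * n)"
  have y: "0 < y" "y \<le> 1 / 8"
    using a n by (auto simp: y_def field_simps)
  have "y powr t \<le> y powr (4 * real d + 1)"
    using y t by (intro powr_mono') auto
  also have "4 * real d + 1 = real (4 * d + 1)"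
    by simp
  also have "y powr real (4 * d + 1) = y ^ (4 * d + 1)"
    using y by (subst powr_realpow) auto
  also have "\<dots> = y ^ (2 * d) * y ^ (2 * d + 1)"
    by (simp flip: power_add)
  also have "\<dots> \<le> y ^ (2 * d) * (1 / 8) ^ (2 * d + 1)"
    using y by (intro mult_left_mono power_mono) auto
  also have "(1 / 8 :: real) ^ (2 * d + 1) = 1 / 2 ^ (3 * (2 * d + 1))"
    by (simp only: power_mult power_divide) simp
  also have "y ^ (2 * d) * (1 / 2 ^ (3 * (2 * d + 1))) \<le> y ^ (2 * d) * (1 / 2 ^ (6 * d + 2))"
    using y by (intro mult_left_mono divide_left_mono power_increasing) auto
  also have "\<dots> = (2 * y) ^ (2 * d) / 2 ^ (8 * d + 2)"
  proof -
    have "(2::real) ^ (8 * d + 2) = 2 ^ (2 * d) * 2 ^ (6 * d + 2)"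
      by (simp flip: power_add)
    then show ?thesis
      by (simp add: power_mult_distrib)
  qed
  finally show ?thesis
    by (simp add: y_def)
qed

section \<open>Propagation along arcs\<close>

text \<open>A discrete intermediate value argument: each term adds at most \<open>c\<close>, so the
  first prefix to reach \<open>s\<close> overshoots by at most \<open>c\<close>.\<close>

lemma sum_prefix_between:
  fixes f :: "nat \<Rightarrow> real"
  assumes "k \<le> m" "0 \<le> s" "s \<le> sum f {k..<m}" "0 \<le> c" "\<And>i. f i \<le> c"
  shows "\<exists>l. k \<le> l \<and> l \<le> m \<and> s \<le> sum f {k..<l} \<and> sum f {k..<l} \<le> s + c"
  using assms(1,3)
proof (induction m rule: dec_induct)
  case base
  then show ?case
    using assms by (intro exI[of _ k]) auto
next
  case (step m)
  show ?case
  proof (cases "s \<le> sum f {k..<m}")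
    case True
    with step show ?thesis
      by (meson le_SucI)
  next
    case False
    with step assms(5)[of m] show ?thesis
      by (intro exI[of _ "Suc m"]) auto
  qed
qed

text \<open>\<open>g k u v\<close> is how far below a common bound the disagreement of \<open>u\<close> and \<open>v\<close> is at
  time \<open>k\<close>. It decays by at most \<open>2 powr - p k\<close> per step and is handed on along the arcs
  of \<open>F\<close> with weight \<open>b * r k\<close>.\<close>

locale gain_process =
  fixes F :: "('n \<times> 'n) set" and p r :: "nat \<Rightarrow> real" and b :: real and k0 :: nat
    and g :: "nat \<Rightarrow> 'n \<Rightarrow> 'n \<Rightarrow> real"
  assumes b: "0 \<le> b" "b \<le> 1"
    and p_nonneg: "0 \<le> p k"
    and r: "0 \<le> r k" "r k \<le> 1"
    and g_nonneg: "k0 \<le> k \<Longrightarrow> 0 \<le> g k u v"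
    and g_sym: "g k u v = g k v u"
    and g_stay: "k0 \<le> k \<Longrightarrow> g (Suc k) u v \<ge> 2 powr - p k * g k u v"
    and g_jump: "k0 \<le> k \<Longrightarrow> (w, u) \<in> F \<Longrightarrow> w \<noteq> u \<Longrightarrow>
      g (Suc k) u v \<ge> 2 powr - p k * g k u v + b * r k * g k w v"
begin

lemma gain_stay:
  assumes "k \<le> m" "k0 \<le> k"
  shows "g m u v \<ge> 2 powr - sum p {k..<m} * g k u v"
  using assms(1)
proof (induction m rule: dec_induct)
  case base
  then show ?case by simp
next
  case (step m)
  have "2 powr - sum p {k..<Suc m} * g k u v = 2 powr - p m * (2 powr - sum p {k..<m} * g k u v)"
    using step by (simp flip: powr_add add: add.commute)
  also have "\<dots> \<le> 2 powr - p m * g m u v"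
    using step by (intro mult_left_mono) auto
  also have "\<dots> \<le> g (Suc m) u v"
    using g_stay step assms by auto
  finally show ?case .
qed

text \<open>A value handed from \<open>w\<close> to \<open>u\<close> decays first at
  \<open>w\<close> and afterwards at \<open>u\<close>, in total by no more than the decay of the
  whole interval, whatever the time of the handover. So the contributions of all times add up to the
  factor \<open>b * sum r {k..<m}\<close>.\<close>

lemma gain_arc:
  assumes "k \<le> m" "k0 \<le> k" and arc: "(w, u) \<in> F" and r_sum: "sum r {k..<m} \<ge> 1"
  shows "g m u v \<ge> 2 powr - sum p {k..<m} * b * g k w v"
\<comment> \<open>\<open>g_jump\<close> excludes loops; for a loop, staying suffices because
  \<open>b\<close> is at most 1.\<close>
proof (cases "w = u")
  case True
  have "2 powr - sum p {k..<m} * b * g k w v \<le> 2 powr - sum p {k..<m} * 1 * g k w v"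
    using b g_nonneg assms by (intro mult_right_mono mult_left_mono) auto
  then show ?thesis
    using gain_stay[OF assms(1,2), of u v] True by (simp only: mult_1_right)
next
  case False
  have "g m u v \<ge> 2 powr - sum p {k..<m} * b * sum r {k..<m} * g k w v"
    using assms(1)
  proof (induction m rule: dec_induct)
    case base
    then show ?case using g_nonneg assms by simp
  next
    case (step m)
    let ?s = "sum p {k..<m}" and ?R = "sum r {k..<m}"
    have "2 powr - sum p {k..<Suc m} * b * sum r {k..<Suc m} * g k w v
        = 2 powr - p m * (2 powr - ?s * b * ?R * g k w v)
          + b * r m * (2 powr - p m * (2 powr - ?s * g k w v))"
      using step by (simp add: powr_add powr_diff powr_minus algebra_simps field_simps)
    \<comment> \<open>The handover at step \<open>m\<close> costs no decay, so its factor
      \<open>2 powr - p m\<close> may be raised to 1.\<close>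
    also have "\<dots> \<le> 2 powr - p m * g m u v + b * r m * (1 * g m w v)"
    proof (intro add_mono mult_left_mono mult_mono)
      show "2 powr - p m \<le> (1::real)"
        using powr_mono[of "- p m" 0 2] p_nonneg[of m] by simp
      show "2 powr - ?s * g k w v \<le> g m w v"
        using gain_stay step assms by auto
    qed (use step b r g_nonneg assms in auto)
    also have "\<dots> \<le> g (Suc m) u v"
      using g_jump[of m w u v] arc False step assms by simp
    finally show ?case .
  qed
  moreover have "2 powr - sum p {k..<m} * b * 1 * g k w v
      \<le> 2 powr - sum p {k..<m} * b * sum r {k..<m} * g k w v"
    using b g_nonneg assms by (intro mult_right_mono mult_left_mono) auto
  ultimately show ?thesis by (simp only: mult_1_right)
qed

text \<open>The slack 1 comes from the bound on \<open>r\<close>. Stopping at 2 l at the latest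
  leaves weight 1 for the next arc out of a budget of 2 (l + 1) - 1.\<close>

lemma ex_prefix:
  assumes "k \<le> m" "2 * real l - 1 \<le> sum r {k..<m}"
  shows "\<exists>j. k \<le> j \<and> j \<le> m \<and> 2 * real l - 1 \<le> sum r {k..<j} \<and> sum r {k..<j} \<le> 2 * real l"
\<comment> \<open>Here the target -1 is negative, which \<open>sum_prefix_between\<close> does not
  cover; the empty prefix serves.\<close>
proof (cases "l = 0")
  case True
  then show ?thesis using assms by (intro exI[of _ k]) auto
next
  case False
  then show ?thesis
    using sum_prefix_between[of k m "2 * real l - 1" r 1] assms r by auto
qed

text \<open>Each arc uses weight 1 plus an overshoot of at most 1, and the last arc needs no
  overshoot: hence 2 l - 1.\<close>

lemma gain_walk:
  assumes "(c, u) \<in> F ^^ l" "k \<le> m" "k0 \<le> k" "sum r {k..<m} \<ge> 2 * real l - 1"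
  shows "g m u v \<ge> 2 powr - sum p {k..<m} * b ^ l * g k c v"
  using assms(1,2,4)
proof (induction l arbitrary: u m)
  case 0
  then show ?case using gain_stay assms(3) by simp
next
  case (Suc l)
  obtain w where w: "(c, w) \<in> F ^^ l" "(w, u) \<in> F"
    using Suc.prems(1) by auto
  obtain j where j: "k \<le> j" "j \<le> m" "2 * real l - 1 \<le> sum r {k..<j}" "sum r {k..<j} \<le> 2 * real l"
    using ex_prefix[of k m l] Suc.prems by auto
  have split: "sum f {k..<m} = sum f {k..<j} + sum f {j..<m}" for f :: "nat \<Rightarrow> real"
    using j by (simp add: sum.atLeastLessThan_concat)
  have "2 powr - sum p {k..<m} * b ^ Suc l * g k c v
      = 2 powr - sum p {j..<m} * b * (2 powr - sum p {k..<j} * b ^ l * g k c v)"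
    by (simp add: split powr_add powr_diff powr_minus field_simps)
  also have "\<dots> \<le> 2 powr - sum p {j..<m} * b * g j w v"
    using Suc.IH[OF w(1) j(1,3)] b by (intro mult_left_mono) auto
  also have "\<dots> \<le> g m u v"
    using gain_arc[OF j(2) _ w(2), of v] j Suc.prems split[of r] assms(3) by simp
  finally show ?case .
qed

text \<open>From \<open>(c, c)\<close> the first entry moves to \<open>u\<close> along one walk; by
  \<open>g_sym\<close> the other entry then moves to \<open>v\<close> in the same way. The first
  walk uses weight at most 2 i, the second needs 2 j - 1.\<close>

lemma gain_pair:
  assumes "(c, u) \<in> F ^^ i" "(c, v) \<in> F ^^ j" "k0 \<le> m" "i \<le> d" "j \<le> d"
    and sum_r: "sum r {k0..<m} \<ge> 4 * real d"
  shows "g m u v \<ge> 2 powr - sum p {k0..<m} * b ^ (2 * d) * g k0 c c"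
proof -
  obtain l where l: "k0 \<le> l" "l \<le> m" "2 * real i - 1 \<le> sum r {k0..<l}" "sum r {k0..<l} \<le> 2 * real i"
    using ex_prefix[of k0 m i] assms by auto
  have split: "sum f {k0..<m} = sum f {k0..<l} + sum f {l..<m}" for f :: "nat \<Rightarrow> real"
    using l by (simp add: sum.atLeastLessThan_concat)
  have "2 powr - sum p {k0..<m} * b ^ (2 * d) * g k0 c c
      \<le> 2 powr - sum p {k0..<m} * b ^ (i + j) * g k0 c c"
    using b g_nonneg assms by (intro mult_right_mono mult_left_mono power_decreasing) auto
  also have "\<dots> = 2 powr - sum p {l..<m} * b ^ j * (2 powr - sum p {k0..<l} * b ^ i * g k0 c c)"
    by (simp add: split powr_add powr_diff powr_minus field_simps power_add)
  also have "\<dots> \<le> 2 powr - sum p {l..<m} * b ^ j * g l u c"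
    using gain_walk[OF assms(1) l(1) order_refl l(3), of c] b by (intro mult_left_mono) auto
  also have "\<dots> = 2 powr - sum p {l..<m} * b ^ j * g l c u"
    by (simp add: g_sym)
  also have "\<dots> \<le> g m v u"
    using gain_walk[OF assms(2) l(2) l(1), of u] assms l split[of r] by simp
  finally show ?thesis
    by (simp add: g_sym)
qed

end

section \<open>One step of the algorithm\<close>

text \<open>A node that does not move counts as averaging with itself, which makes a step one
  formula for all nodes.\<close>

definition pulled_to :: "('n \<times> 'n) \<times> bool \<times> bool \<Rightarrow> 'n \<Rightarrow> 'n" where
  "pulled_to z l =
    (case z of ((i, j), rp, rm) \<Rightarrow>
      if l = i \<and> rp then j else if l = j \<and> rm then i else l)"

abbreviation step_by :: "('n \<times> 'n) \<times> bool \<times> bool \<Rightarrow> real^'n::finite \<Rightarrow> real^'n" where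
  "step_by z x \<equiv> gossip_step (fst z) (fst (snd z)) (snd (snd z)) x"

lemma step_by_nth: "step_by z x $ l = x $ l / 2 + x $ pulled_to z l / 2"
  by (cases z) (auto simp: gossip_step_def pulled_to_def)

text \<open>If \<open>u\<close> moves, then \<open>v\<close> may be regarded as fixed: should \<open>v\<close> move too, then
  \<open>u\<close> and \<open>v\<close> average with each other and end up equal.\<close>

definition dominating_pair :: "('n \<times> 'n) \<times> bool \<times> bool \<Rightarrow> 'n \<Rightarrow> 'n \<Rightarrow> 'n \<times> 'n" where
  "dominating_pair z u v =
    (if pulled_to z u \<noteq> u then (pulled_to z u, v) else (u, pulled_to z v))"

lemma step_by_diff_le:
  assumes "dominating_pair z u v = (a, b)"
  shows "\<bar>step_by z x $ u - step_by z x $ v\<bar> \<le> \<bar>x $ u - x $ v\<bar> / 2 + \<bar>x $ a - x $ b\<bar> / 2"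
proof -
  consider "(a, b) = (pulled_to z u, pulled_to z v)" | "step_by z x $ u = step_by z x $ v"
  proof (cases "pulled_to z u = u \<or> pulled_to z v = v")
    case True
    then show ?thesis
      using assms that(1) by (auto simp: dominating_pair_def split: if_splits)
  next
    case False
    then have "u = v \<or> pulled_to z u = v \<and> pulled_to z v = u"
      by (cases z) (auto simp: pulled_to_def split: if_splits)
    then show ?thesis
      by (intro that(2)) (auto simp: step_by_nth)
  qed
  then show ?thesis
  proof cases
    case 1
    then have "step_by z x $ u - step_by z x $ v = (x $ u - x $ v) / 2 + (x $ a - x $ b) / 2"
      by (simp add: step_by_nth field_simps)
    then show ?thesis
      using abs_triangle_ineq[of "(x $ u - x $ v) / 2" "(x $ a - x $ b) / 2"] by simp
  qed auto
qed

text \<open>Bounds the weight of an unchanged pair, with q the probability of a quiet step, by an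
  exponential, so that the factors of successive steps multiply to 2 to the minus total weight. For
  s \<le> 1 the chord of the convex function gives 2^(-s) \<le> 1 - s/2; beyond 1 the value 1/2
  suffices.\<close>

lemma powr_stay_le:
  fixes s :: real
  assumes "0 \<le> s" "q \<ge> 0" "q \<ge> 1 - s"
  shows "2 powr - s \<le> 1 / 2 + q / 2"
proof (cases "s \<le> 1")
  case True
  have "exp (- ln 2 * s) \<le> (1 - s) * exp (0::real) + s * exp (- ln 2)"
    using convex_onD[OF exp_convex, of s 0 "- ln 2"] True assms by (simp add: mult.commute)
  then have "2 powr - s \<le> 1 - s / 2"
    by (simp add: powr_def exp_minus field_simps)
  then show ?thesis using assms by simp
next
  case False
  then have "2 powr - s \<le> 2 powr (-1::real)"
    by (intro powr_mono) auto
  then show ?thesis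
    using assms by (simp add: powr_minus)
qed

section \<open>Independence of the one-step outcomes\<close>

context gossip_network
begin

definition outcome :: "nat \<Rightarrow> 'w \<Rightarrow> ('n \<times> 'n) \<times> bool \<times> bool" where
  "outcome k \<omega> = (sel k \<omega>, \<omega> \<in> Ep k, \<omega> \<in> Em k)"

lemma sel_measurable [measurable]: "sel k \<in> measurable M (count_space UNIV)"
  using sel_indep by (simp add: indep_vars_def)

lemma comm_measurable [measurable]:
  "(\<lambda>\<omega>. (\<omega> \<in> Ep k, \<omega> \<in> Em k)) \<in> measurable M (count_space UNIV)"
  using comm_indep by (simp add: indep_vars_def)

lemma outcome_measurable [measurable]: "outcome k \<in> measurable M (count_space UNIV)"
proof -
  have "(\<lambda>\<omega>. (sel k \<omega>, (\<omega> \<in> Ep k, \<omega> \<in> Em k))) \<in> measurable M (count_space UNIV \<Otimes>\<^sub>M count_space UNIV)"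
    by (rule measurable_Pair) measurable
  then show ?thesis
    by (simp add: outcome_def[abs_def] pair_measure_countable)
qed

text \<open>First the two processes separate by \<open>sel_comm_indep\<close>, then each factorizes
  over time.\<close>

lemma prob_cylinders:
  assumes "finite J" "J \<noteq> {}"
  shows "prob (\<Inter>k\<in>J. outcome k -` (S k \<times> C k) \<inter> space M)
    = (\<Prod>k\<in>J. prob (sel k -` S k \<inter> space M) *
        prob ((\<lambda>\<omega>. (\<omega> \<in> Ep k, \<omega> \<in> Em k)) -` C k \<inter> space M))"
    (is "prob ?R = _")
proof -
  let ?comm = "\<lambda>k \<omega>. (\<omega> \<in> Ep k, \<omega> \<in> Em k)"
  have cyl: "(\<Inter>k\<in>J. Y k -` B k \<inter> space M) \<in>
      sets (vimage_algebra (space M) (\<lambda>\<omega> k. Y k \<omega>) (Pi\<^sub>M UNIV (\<lambda>_. count_space UNIV)))"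
    for Y :: "nat \<Rightarrow> 'w \<Rightarrow> 'b" and B
  proof -
    let ?A = "prod_emb UNIV (\<lambda>_. count_space UNIV) J (Pi\<^sub>E J B)"
    have "?A \<in> sets (Pi\<^sub>M UNIV (\<lambda>_. count_space UNIV))"
      using assms by (intro sets_PiM_I) auto
    then have "(\<lambda>\<omega> k. Y k \<omega>) -` ?A \<inter> space M \<in>
        sets (vimage_algebra (space M) (\<lambda>\<omega> k. Y k \<omega>) (Pi\<^sub>M UNIV (\<lambda>_. count_space UNIV)))"
      by (rule in_vimage_algebra)
    also have "(\<lambda>\<omega> k. Y k \<omega>) -` ?A \<inter> space M = (\<Inter>k\<in>J. Y k -` B k \<inter> space M)"
      using assms(2) by (auto simp: prod_emb_def PiE_iff)
    finally show ?thesis .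
  qed
  have "?R = (\<Inter>k\<in>J. sel k -` S k \<inter> space M) \<inter> (\<Inter>k\<in>J. ?comm k -` C k \<inter> space M)"
    using assms by (auto simp: outcome_def)
  also have "prob \<dots> = prob (\<Inter>k\<in>J. sel k -` S k \<inter> space M) * prob (\<Inter>k\<in>J. ?comm k -` C k \<inter> space M)"
    by (rule indep_setD[OF sel_comm_indep]) (rule cyl)+
  also have "prob (\<Inter>k\<in>J. sel k -` S k \<inter> space M) = (\<Prod>k\<in>J. prob (sel k -` S k \<inter> space M))"
    using assms by (intro indep_varsD[OF sel_indep]) auto
  also have "prob (\<Inter>k\<in>J. ?comm k -` C k \<inter> space M) = (\<Prod>k\<in>J. prob (?comm k -` C k \<inter> space M))"
    using assms by (intro indep_varsD[OF comm_indep]) auto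
  finally show ?thesis
    by (simp add: prod.distrib)
qed

lemma prob_outcome_rectangle:
  "prob (outcome k -` (S \<times> C) \<inter> space M)
    = prob (sel k -` S \<inter> space M) * prob ((\<lambda>\<omega>. (\<omega> \<in> Ep k, \<omega> \<in> Em k)) -` C \<inter> space M)"
  using prob_cylinders[of "{k}" "\<lambda>_. S" "\<lambda>_. C"] by simp

text \<open>Rectangles are an intersection-stable family for which \<open>prob_cylinders\<close>
  gives the product rule; the rule extends to the generated sigma-algebras.\<close>

lemma outcome_indep: "indep_vars (\<lambda>_. count_space UNIV) outcome UNIV"
proof -
  define R where "R k = {outcome k -` (S \<times> C) \<inter> space M | S C. True}" for k
  have "indep_sets R UNIV"
  proof (rule indep_setsI)
    show "R k \<subseteq> events" for k
      by (auto simp: R_def intro!: measurable_sets[OF outcome_measurable])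
    show "prob (\<Inter> (B ` J)) = (\<Prod>k\<in>J. prob (B k))"
      if J: "J \<noteq> {}" "J \<subseteq> UNIV" "finite J" "\<forall>k\<in>J. B k \<in> R k" for B J
    proof -
      obtain S C where "\<And>k. k \<in> J \<Longrightarrow> B k = outcome k -` (S k \<times> C k) \<inter> space M"
        using J(4) unfolding R_def by simp metis
      then have "prob (\<Inter> (B ` J)) = prob (\<Inter>k\<in>J. outcome k -` (S k \<times> C k) \<inter> space M)"
        "(\<Prod>k\<in>J. prob (B k)) = (\<Prod>k\<in>J. prob (outcome k -` (S k \<times> C k) \<inter> space M))"
        by auto
      then show ?thesis
        using prob_cylinders[OF J(3,1), of S C] by (simp only: prob_outcome_rectangle)
    qed
  qed
  moreover have "Int_stable (R k)" for k
  proof (rule Int_stableI)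
    fix a b assume "a \<in> R k" "b \<in> R k"
    then obtain S C S' C' where "a = outcome k -` (S \<times> C) \<inter> space M"
      "b = outcome k -` (S' \<times> C') \<inter> space M"
      by (auto simp: R_def)
    then have "a \<inter> b = outcome k -` ((S \<inter> S') \<times> (C \<inter> C')) \<inter> space M"
      by auto
    then show "a \<inter> b \<in> R k"
      unfolding R_def by blast
  qed
  ultimately have "indep_sets (\<lambda>k. sigma_sets (space M) (R k)) UNIV"
    by (rule indep_sets_sigma)
  then have "indep_sets (\<lambda>k. {outcome k -` A \<inter> space M | A. A \<in> sets (count_space UNIV)}) UNIV"
  proof (rule indep_sets_mono_sets)
    fix k
    interpret sigma_algebra "space M" "sigma_sets (space M) (R k)"
      by (rule sigma_algebra_sigma_sets) (auto simp: R_def)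
    show "{outcome k -` A \<inter> space M | A. A \<in> sets (count_space UNIV)} \<subseteq> sigma_sets (space M) (R k)"
    proof safe
      fix A :: "(('n \<times> 'n) \<times> bool \<times> bool) set"
      have "outcome k -` {(s, c)} \<inter> space M \<in> R k" for s c
      proof -
        have "outcome k -` {(s, c)} \<inter> space M = outcome k -` ({s} \<times> {c}) \<inter> space M"
          by auto
        then show ?thesis unfolding R_def by blast
      qed
      \<comment> \<open>There are finitely many outcomes, so every event about the outcome is a
        finite union of one-point rectangles.\<close>
      then have "(\<Union>(s, c)\<in>A. outcome k -` {(s, c)} \<inter> space M) \<in> sigma_sets (space M) (R k)"
        by (intro finite_UN) auto
      also have "(\<Union>(s, c)\<in>A. outcome k -` {(s, c)} \<inter> space M) = outcome k -` A \<inter> space M"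
        by auto
      finally show "outcome k -` A \<inter> space M \<in> sigma_sets (space M) (R k)" .
    qed
  qed
  then show ?thesis
    by (simp add: indep_vars_def2)
qed

section \<open>The state as a function of the past, and the expected gaps\<close>

abbreviation state :: "nat \<Rightarrow> real^'n \<Rightarrow> nat \<Rightarrow> 'w \<Rightarrow> real^'n" where
  "state \<equiv> gossip_state sel Ep Em"

definition mean_gap :: "nat \<Rightarrow> real^'n \<Rightarrow> nat \<Rightarrow> 'n \<Rightarrow> 'n \<Rightarrow> real" where
  "mean_gap k0 x0 k u v = expectation (\<lambda>\<omega>. \<bar>state k0 x0 k \<omega> $ u - state k0 x0 k \<omega> $ v\<bar>)"

text \<open>The same algorithm, instantiated on the canonical space of outcome sequences: it exhibits the
  state as a function of the past outcomes.\<close>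

definition replay :: "nat \<Rightarrow> real^'n \<Rightarrow> nat \<Rightarrow> (nat \<Rightarrow> ('n \<times> 'n) \<times> bool \<times> bool) \<Rightarrow> real^'n" where
  "replay = gossip_state (\<lambda>l h. fst (h l)) (\<lambda>l. {h. fst (snd (h l))}) (\<lambda>l. {h. snd (snd (h l))})"

lemma state_eq_replay:
  "(\<And>l. l < k \<Longrightarrow> h l = outcome l \<omega>) \<Longrightarrow> state k0 x0 k \<omega> = replay k0 x0 k h"
  by (induction k) (auto simp: replay_def outcome_def)

lemma state_Suc:
  "k0 \<le> k \<Longrightarrow> state k0 x0 (Suc k) \<omega> = step_by (outcome k \<omega>) (state k0 x0 k \<omega>)"
  by (simp add: outcome_def)

lemma PiM_outcomes:
  "finite J \<Longrightarrow> Pi\<^sub>M J (\<lambda>_. count_space UNIV) =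
    count_space (Pi\<^sub>E J (\<lambda>_. UNIV :: (('n \<times> 'n) \<times> bool \<times> bool) set))"
  by (intro count_space_PiM_finite) auto

text \<open>\<open>replay\<close> expresses the state at time \<open>k\<close> through the outcomes
  at times below \<open>k\<close>, a block disjoint from \<open>k\<close> itself. The product spaces
  over these finite blocks are discrete, so every function on them is measurable.\<close>

lemma state_outcome_indep:
  fixes f :: "real^'n \<Rightarrow> real" and g :: "('n \<times> 'n) \<times> bool \<times> bool \<Rightarrow> real"
  shows "indep_var borel (\<lambda>\<omega>. f (state k0 x0 k \<omega>)) borel (\<lambda>\<omega>. g (outcome k \<omega>))"
proof -
  have "indep_var (Pi\<^sub>M {..<k} (\<lambda>_. count_space UNIV)) (\<lambda>\<omega>. restrict (\<lambda>l. outcome l \<omega>) {..<k})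
      (Pi\<^sub>M {k} (\<lambda>_. count_space UNIV)) (\<lambda>\<omega>. restrict (\<lambda>l. outcome l \<omega>) {k})"
    by (rule indep_var_restrict[OF outcome_indep]) auto
  then have "indep_var borel ((f \<circ> replay k0 x0 k) \<circ> (\<lambda>\<omega>. restrict (\<lambda>l. outcome l \<omega>) {..<k}))
      borel ((\<lambda>h. g (h k)) \<circ> (\<lambda>\<omega>. restrict (\<lambda>l. outcome l \<omega>) {k}))"
    by (rule indep_var_compose) (auto simp: PiM_outcomes)
  moreover have "(f \<circ> replay k0 x0 k) \<circ> (\<lambda>\<omega>. restrict (\<lambda>l. outcome l \<omega>) {..<k}) = (\<lambda>\<omega>. f (state k0 x0 k \<omega>))"
    by (auto simp: fun_eq_iff intro!: arg_cong[of _ _ f] state_eq_replay[symmetric])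
  moreover have "(\<lambda>h. g (h k)) \<circ> (\<lambda>\<omega>. restrict (\<lambda>l. outcome l \<omega>) {k}) = (\<lambda>\<omega>. g (outcome k \<omega>))"
    by (auto simp: fun_eq_iff)
  ultimately show ?thesis by simp
qed

lemma state_measurable [measurable]: "state k0 x0 k \<in> measurable M (count_space UNIV)"
proof -
  have "(\<lambda>\<omega>. restrict (\<lambda>l. outcome l \<omega>) {..<k}) \<in> measurable M (Pi\<^sub>M {..<k} (\<lambda>_. count_space UNIV))"
    by (rule measurable_restrict) measurable
  then have "(\<lambda>\<omega>. replay k0 x0 k (restrict (\<lambda>l. outcome l \<omega>) {..<k})) \<in> measurable M (count_space UNIV)"
    by (rule measurable_compose) (simp add: PiM_outcomes)
  also have "(\<lambda>\<omega>. replay k0 x0 k (restrict (\<lambda>l. outcome l \<omega>) {..<k})) = state k0 x0 k"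
    by (auto simp: fun_eq_iff intro!: state_eq_replay[symmetric])
  finally show ?thesis .
qed

text \<open>Needed for integrability: a step replaces a gap by at most the mean of two earlier ones,
  so the bound for \<open>x0\<close> persists.\<close>

lemma state_gap_bounded: "\<exists>b. \<forall>\<omega> u v. \<bar>state k0 x0 k \<omega> $ u - state k0 x0 k \<omega> $ v\<bar> \<le> b"
proof (induction k)
  case 0
  have "\<bar>x0 $ u - x0 $ v\<bar> \<le> (\<Sum>(u, v)\<in>UNIV. \<bar>x0 $ u - x0 $ v\<bar>)" for u v
    using member_le_sum[of "(u, v)" UNIV "\<lambda>(u, v). \<bar>x0 $ u - x0 $ v\<bar>"] by auto
  then show ?case by auto
next
  case (Suc k)
  then obtain b where b: "\<And>\<omega> u v. \<bar>state k0 x0 k \<omega> $ u - state k0 x0 k \<omega> $ v\<bar> \<le> b"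
    by blast
  show ?case
  proof (cases "k < k0")
    case True
    have "state k0 x0 k \<omega> = x0" for \<omega>
      using True by (cases k) auto
    then show ?thesis using b True by auto
  next
    case False
    have "\<bar>state k0 x0 (Suc k) \<omega> $ u - state k0 x0 (Suc k) \<omega> $ v\<bar> \<le> b" for \<omega> u v
    proof -
      obtain a c where "dominating_pair (outcome k \<omega>) u v = (a, c)"
        by fastforce
      from step_by_diff_le[OF this, of "state k0 x0 k \<omega>"] b[of \<omega> u v] b[of \<omega> a c] False
      show ?thesis by (subst (1 2) state_Suc) auto
    qed
    then show ?thesis by blast
  qed
qed

lemma integrable_gap [simp]:
  "integrable M (\<lambda>\<omega>. \<bar>state k0 x0 k \<omega> $ u - state k0 x0 k \<omega> $ v\<bar>)"
proof -
  obtain b where b: "\<And>\<omega> u v. \<bar>state k0 x0 k \<omega> $ u - state k0 x0 k \<omega> $ v\<bar> \<le> b"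
    using state_gap_bounded by blast
  show ?thesis
    by (rule integrable_const_bound[where B = b])
      (use b in \<open>auto intro!: measurable_compose[OF state_measurable]\<close>)
qed

lemma expectation_outcome_gap:
  "integrable M (\<lambda>\<omega>. indicator {z} (outcome k \<omega>) * \<bar>state k0 x0 k \<omega> $ u - state k0 x0 k \<omega> $ v\<bar>)"
  "expectation (\<lambda>\<omega>. indicator {z} (outcome k \<omega>) * \<bar>state k0 x0 k \<omega> $ u - state k0 x0 k \<omega> $ v\<bar>)
    = prob (outcome k -` {z} \<inter> space M) * mean_gap k0 x0 k u v"
proof -
  let ?f = "\<lambda>x :: real^'n. \<bar>x $ u - x $ v\<bar>"
  have ind: "indep_var borel (\<lambda>\<omega>. ?f (state k0 x0 k \<omega>)) borel (\<lambda>\<omega>. indicator {z} (outcome k \<omega>) :: real)"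
    by (rule state_outcome_indep)
  have int: "integrable M (\<lambda>\<omega>. indicator {z} (outcome k \<omega>) :: real)"
    by (rule integrable_const_bound[where B = 1])
      (auto simp: indicator_def intro!: measurable_compose[OF outcome_measurable])
  have "(\<lambda>\<omega>. indicator {z} (outcome k \<omega>)) = (indicator (outcome k -` {z}) :: 'w \<Rightarrow> real)"
    by (auto simp: indicator_def)
  then have "expectation (\<lambda>\<omega>. indicator {z} (outcome k \<omega>)) = prob (outcome k -` {z} \<inter> space M)"
    by simp
  then show "expectation (\<lambda>\<omega>. indicator {z} (outcome k \<omega>) * ?f (state k0 x0 k \<omega>))
      = prob (outcome k -` {z} \<inter> space M) * mean_gap k0 x0 k u v"
    using indep_var_lebesgue_integral[OF ind integrable_gap int]
    by (simp add: mean_gap_def mult.commute)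
  show "integrable M (\<lambda>\<omega>. indicator {z} (outcome k \<omega>) * ?f (state k0 x0 k \<omega>))"
    using indep_var_integrable[OF ind integrable_gap int] by (simp add: mult.commute)
qed

lemma sum_prob_outcome:
  "(\<Sum>z\<in>Z. prob (outcome k -` {z} \<inter> space M)) = prob (outcome k -` Z \<inter> space M)"
proof -
  have "prob (\<Union>z\<in>Z. outcome k -` {z} \<inter> space M) = (\<Sum>z\<in>Z. prob (outcome k -` {z} \<inter> space M))"
    by (rule finite_measure_finite_Union)
      (auto simp: disjoint_family_on_def intro!: measurable_sets[OF outcome_measurable])
  moreover have "(\<Union>z\<in>Z. outcome k -` {z} \<inter> space M) = outcome k -` Z \<inter> space M"
    by auto
  ultimately show ?thesis by simp
qed

text \<open>Splitting over the outcome of step \<open>k\<close> gives summands that are an indicator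
  times a gap at time \<open>k\<close>; independence factors their expectations.\<close>

lemma mean_gap_Suc_le:
  assumes "k0 \<le> k"
  shows "mean_gap k0 x0 (Suc k) u v \<le> (\<Sum>z\<in>UNIV. prob (outcome k -` {z} \<inter> space M) *
    (mean_gap k0 x0 k u v / 2 + case_prod (mean_gap k0 x0 k) (dominating_pair z u v) / 2))"
proof -
  let ?gap = "\<lambda>\<omega> u v. \<bar>state k0 x0 k \<omega> $ u - state k0 x0 k \<omega> $ v\<bar>"
  let ?bound = "\<lambda>z \<omega>. indicator {z} (outcome k \<omega>) * ?gap \<omega> u v / 2 +
    indicator {z} (outcome k \<omega>) * ?gap \<omega> (fst (dominating_pair z u v)) (snd (dominating_pair z u v)) / 2"
  have "mean_gap k0 x0 (Suc k) u v \<le> expectation (\<lambda>\<omega>. \<Sum>z\<in>UNIV. ?bound z \<omega>)"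
    unfolding mean_gap_def
  proof (rule integral_mono)
    show "\<bar>state k0 x0 (Suc k) \<omega> $ u - state k0 x0 (Suc k) \<omega> $ v\<bar> \<le> (\<Sum>z\<in>UNIV. ?bound z \<omega>)" for \<omega>
    proof -
      let ?z = "outcome k \<omega>"
      \<comment> \<open>All summands but that of the outcome that occurs vanish.\<close>
      have "\<bar>state k0 x0 (Suc k) \<omega> $ u - state k0 x0 (Suc k) \<omega> $ v\<bar> \<le> ?bound ?z \<omega>"
        using step_by_diff_le[of ?z u v _ _ "state k0 x0 k \<omega>", OF prod.collapse[symmetric]] assms
        by (subst (1 2) state_Suc) auto
      also have "\<dots> \<le> (\<Sum>z\<in>UNIV. ?bound z \<omega>)"
        by (rule member_le_sum) auto
      finally show ?thesis .
    qed
    show "integrable M (\<lambda>\<omega>. \<Sum>z\<in>UNIV. ?bound z \<omega>)"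
      by (intro Bochner_Integration.integrable_sum Bochner_Integration.integrable_add
          integrable_divide expectation_outcome_gap)
  qed (rule integrable_gap)
  also have "\<dots> = (\<Sum>z\<in>UNIV. expectation (?bound z))"
    by (intro Bochner_Integration.integral_sum Bochner_Integration.integrable_add
        integrable_divide expectation_outcome_gap)
  also have "\<dots> = (\<Sum>z\<in>UNIV. prob (outcome k -` {z} \<inter> space M) *
    (mean_gap k0 x0 k u v / 2 + case_prod (mean_gap k0 x0 k) (dominating_pair z u v) / 2))"
  proof (rule sum.cong)
    fix z
    show "expectation (?bound z) = prob (outcome k -` {z} \<inter> space M) *
      (mean_gap k0 x0 k u v / 2 + case_prod (mean_gap k0 x0 k) (dominating_pair z u v) / 2)"
      by (subst Bochner_Integration.integral_add)
        (auto simp: expectation_outcome_gap integrable_divide split_beta distrib_left)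
  qed auto
  finally show ?thesis .
qed

definition quiet :: "(('n \<times> 'n) \<times> bool \<times> bool) set" where
  "quiet = UNIV \<times> {(False, False)}"

lemma dominating_pair_quiet: "z \<in> quiet \<Longrightarrow> dominating_pair z u v = (u, v)"
  by (auto simp: quiet_def dominating_pair_def pulled_to_def)

lemma prob_quiet_ge: "prob (outcome k -` quiet \<inter> space M) \<ge> 1 - (Pp k + Pm k)"
proof -
  have "1 - prob (outcome k -` quiet \<inter> space M) = prob (space M - outcome k -` quiet \<inter> space M)"
    by (rule prob_compl[symmetric]) (auto intro!: measurable_sets[OF outcome_measurable])
  also have "space M - outcome k -` quiet \<inter> space M = Ep k \<union> Em k"
    using sets.sets_into_space[OF Ep_event] sets.sets_into_space[OF Em_event]
    by (auto simp: quiet_def outcome_def)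
  also have "prob \<dots> \<le> prob (Ep k) + prob (Em k)"
    using Ep_event Em_event by (rule measure_Un_le)
  finally show ?thesis
    by (simp add: Ep_prob Em_prob)
qed

text \<open>The one-step inequality behind \<open>gain_process\<close>. Half of the weight always
  stays at \<open>(u, v)\<close>, quiet outcomes return the other half too, and outcomes in
  \<open>Z\<close> move it to \<open>(w, v)\<close>. The remaining outcomes contribute nonnegative
  deficits and are dropped.\<close>

lemma deficit_Suc_ge:
  assumes "k0 \<le> k" and bound: "\<And>a b. mean_gap k0 x0 k a b \<le> B"
    and Z: "Z \<inter> quiet = {}" "\<And>z. z \<in> Z \<Longrightarrow> dominating_pair z u v = (w, v)"
  shows "B - mean_gap k0 x0 (Suc k) u v \<ge>
    2 powr - (Pp k + Pm k) * (B - mean_gap k0 x0 k u v) +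
    prob (outcome k -` Z \<inter> space M) / 2 * (B - mean_gap k0 x0 k w v)"
proof -
  let ?q = "\<lambda>z. prob (outcome k -` {z} \<inter> space M)"
  let ?D = "mean_gap k0 x0 k"
  let ?E = "\<lambda>z. B - case_prod ?D (dominating_pair z u v)"
  let ?Q = "\<lambda>Z. prob (outcome k -` Z \<inter> space M)"
  have nonneg: "?q z * ?E z \<ge> 0" for z
    using bound by (auto simp: split_beta)
  have "2 powr - (Pp k + Pm k) \<le> 1 / 2 + ?Q quiet / 2"
    using prob_quiet_ge[of k] Pp_range[of k] Pm_range[of k] by (intro powr_stay_le) auto
  then have "2 powr - (Pp k + Pm k) * (B - ?D u v) \<le> (1 / 2 + ?Q quiet / 2) * (B - ?D u v)"
    using bound by (intro mult_right_mono) auto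
  moreover have "?Q quiet * (B - ?D u v) = (\<Sum>z\<in>quiet. ?q z * ?E z)"
    by (simp add: sum_prob_outcome[of k quiet, symmetric] sum_distrib_right dominating_pair_quiet)
  moreover have "?Q Z * (B - ?D w v) = (\<Sum>z\<in>Z. ?q z * ?E z)"
    by (simp add: sum_prob_outcome[of k Z, symmetric] sum_distrib_right Z)
  moreover have "(\<Sum>z\<in>quiet. ?q z * ?E z) + (\<Sum>z\<in>Z. ?q z * ?E z) = (\<Sum>z\<in>quiet \<union> Z. ?q z * ?E z)"
    using Z by (intro sum.union_disjoint[symmetric]) auto
  moreover have "\<dots> \<le> (\<Sum>z\<in>UNIV. ?q z * ?E z)"
    using nonneg by (intro sum_mono2) auto
  \<comment> \<open>The outcome probabilities add up to 1, so averages of gaps turn into averages of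
    deficits.\<close>
  moreover have "(\<Sum>z\<in>UNIV. ?q z * ?E z)
      = 2 * (B - (\<Sum>z\<in>UNIV. ?q z * (?D u v / 2 + case_prod ?D (dominating_pair z u v) / 2)))
        - (B - ?D u v)"
  proof -
    have one: "(\<Sum>z\<in>UNIV. ?q z) = 1"
      by (simp add: sum_prob_outcome prob_space)
    have "(\<Sum>z\<in>UNIV. ?q z * ?E z)
      = (\<Sum>z\<in>UNIV. ?q z * (B + ?D u v) - 2 * (?q z * (?D u v / 2 + case_prod ?D (dominating_pair z u v) / 2)))"
      by (intro sum.cong) (auto simp: algebra_simps)
    also have "\<dots> = (B + ?D u v) - 2 * (\<Sum>z\<in>UNIV. ?q z * (?D u v / 2 + case_prod ?D (dominating_pair z u v) / 2))"
      by (simp add: sum_subtractf one sum_distrib_left[symmetric] sum_distrib_right[symmetric])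
    finally show ?thesis by simp
  qed
  moreover note mean_gap_Suc_le[OF assms(1), of x0 u v]
  ultimately show ?thesis
    by (simp add: algebra_simps)
qed

lemma mean_gap_Suc_bound:
  assumes "k0 \<le> k" "\<And>a b. mean_gap k0 x0 k a b \<le> B"
  shows "mean_gap k0 x0 (Suc k) u v \<le> B"
proof -
  have "0 \<le> 2 powr - (Pp k + Pm k) * (B - mean_gap k0 x0 k u v)"
    using assms by auto
  with deficit_Suc_ge[OF assms, of "{}" u v v] show ?thesis
    by auto
qed

lemma mean_gap_bound:
  assumes "k \<le> m" "k0 \<le> k" "\<And>a b. mean_gap k0 x0 k a b \<le> B"
  shows "mean_gap k0 x0 m u v \<le> B"
  using assms(1)
  by (induction m arbitrary: u v rule: dec_induct) (use assms mean_gap_Suc_bound in auto)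

lemma prob_pull_plus:
  "prob (outcome k -` ({(u, w)} \<times> {c. fst c}) \<inter> space M) = A $ u $ w / real CARD('n) * Pp k"
proof -
  have "(\<lambda>\<omega>. (\<omega> \<in> Ep k, \<omega> \<in> Em k)) -` {c. fst c} \<inter> space M = Ep k"
    using sets.sets_into_space[OF Ep_event] by auto
  moreover have "sel k -` {(u, w)} \<inter> space M = {\<omega> \<in> space M. sel k \<omega> = (u, w)}"
    by auto
  ultimately show ?thesis
    by (simp add: prob_outcome_rectangle sel_prob Ep_prob)
qed

lemma prob_pull_minus:
  "prob (outcome k -` ({(w, u)} \<times> {c. snd c}) \<inter> space M) = A $ w $ u / real CARD('n) * Pm k"
proof -
  have "(\<lambda>\<omega>. (\<omega> \<in> Ep k, \<omega> \<in> Em k)) -` {c. snd c} \<inter> space M = Em k"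
    using sets.sets_into_space[OF Em_event] by auto
  moreover have "sel k -` {(w, u)} \<inter> space M = {\<omega> \<in> space M. sel k \<omega> = (w, u)}"
    by auto
  ultimately show ?thesis
    by (simp add: prob_outcome_rectangle sel_prob Em_prob)
qed

end

section \<open>Contraction over blocks\<close>

lemma abs_diff_le_spread: "\<bar>x $ u - x $ v\<bar> \<le> spread x" for x :: "real^'n::finite"
proof -
  have "x $ w \<le> Max (range (\<lambda>i. x $ i))" "Min (range (\<lambda>i. x $ i)) \<le> x $ w" for w
    by auto
  from this[of u] this[of v] show ?thesis
    unfolding spread_def by linarith
qed

lemma spread_eq_diff: "\<exists>u v. spread x = x $ u - x $ v" for x :: "real^'n::finite"
proof -
  have "Max (range (\<lambda>i. x $ i)) \<in> range (\<lambda>i. x $ i)"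
    by (rule Max_in) auto
  then obtain u where u: "Max (range (\<lambda>i. x $ i)) = x $ u"
    by blast
  have "Min (range (\<lambda>i. x $ i)) \<in> range (\<lambda>i. x $ i)"
    by (rule Min_in) auto
  then obtain v where "Min (range (\<lambda>i. x $ i)) = x $ v"
    by blast
  with u show ?thesis
    unfolding spread_def by auto
qed

text \<open>Replaces a maximum by a sum over pairs, whose expectation is a sum of mean gaps; this
  costs the factor n^2 in \<open>prob_spread_ge\<close>.\<close>

lemma spread_le_sum: "spread x \<le> (\<Sum>(u, v)\<in>UNIV. \<bar>x $ u - x $ v\<bar>)" for x :: "real^'n::finite"
proof -
  obtain u v where "spread x = x $ u - x $ v"
    using spread_eq_diff by blast
  then show ?thesis
    using member_le_sum[of "(u, v)" UNIV "\<lambda>(u, v). \<bar>x $ u - x $ v\<bar>"] by auto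
qed

lemma sum_windows_ge:
  fixes f :: "nat \<Rightarrow> real"
  assumes "\<And>m. sum f {m..<m + T} \<ge> p"
  shows "sum f {k..<k + T * q} \<ge> real q * p"
proof (induction q)
  case (Suc q)
  have "sum f {k..<k + T * Suc q} = sum f {k..<k + T * q} + sum f {k + T * q..<k + T * q + T}"
    by (subst sum.atLeastLessThan_concat) (auto simp: algebra_simps)
  with Suc assms[of "k + T * q"] show ?case
    by (simp add: algebra_simps)
qed simp

locale connected_gossip_network = gossip_network M A Pp Pm sel Ep Em
  for M :: "'w measure" and A :: "real^'n::finite^'n" and Pp Pm sel Ep Em +
  assumes card: "CARD('n) \<ge> 3"
    and center: "quasi_strongly_connected (induced_graph A)"
    and anticenter: "quasi_strongly_connected ((induced_graph A)\<inverse>)"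
begin

lemma mean_gap_self: "mean_gap k0 x0 k u u = 0"
  by (simp add: mean_gap_def)

lemma mean_gap_sym: "mean_gap k0 x0 k u v = mean_gap k0 x0 k v u"
  by (simp add: mean_gap_def abs_minus_commute)

lemma a_star_bounds: "0 < a_star A" "a_star A \<le> 1"
proof -
  obtain i j where ij: "A $ i $ j > 0" "a_star A = A $ i $ j"
    using a_star_attained[OF A_nonneg card center anticenter] by blast
  moreover have "A $ i $ j \<le> (\<Sum>j\<in>UNIV. A $ i $ j)"
    by (rule member_le_sum) (auto simp: A_nonneg)
  ultimately show "0 < a_star A" "a_star A \<le> 1"
    by (auto simp: A_row_sum)
qed

text \<open>Selecting \<open>(u, w)\<close> with reception by the first node pulls \<open>u\<close>
  towards \<open>w\<close>, along the arc \<open>(w, u)\<close>. Starting at \<open>k1\<close>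
  instead of \<open>k0\<close> lets \<open>B\<close> be renewed at each block.\<close>

lemma gain_process_plus:
  assumes "k0 \<le> k1" "\<And>a b. mean_gap k0 x0 k1 a b \<le> B"
  shows "gain_process (induced_graph A) (\<lambda>k. Pp k + Pm k) Pp (a_star A / (2 * real CARD('n))) k1
    (\<lambda>k u v. B - mean_gap k0 x0 k u v)"
proof
  have bound: "mean_gap k0 x0 k a b \<le> B" if "k1 \<le> k" for k a b
    by (rule mean_gap_bound[OF that assms])
  show "0 \<le> a_star A / (2 * real CARD('n))" "a_star A / (2 * real CARD('n)) \<le> 1"
    using a_star_bounds card by (auto simp: field_simps)
  show "0 \<le> Pp k + Pm k" "0 \<le> Pp k" "Pp k \<le> 1" for k
    using Pp_range[of k] Pm_range[of k] by auto
  show "0 \<le> B - mean_gap k0 x0 k u v" if "k1 \<le> k" for k u v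
    using bound that by simp
  show "B - mean_gap k0 x0 k u v = B - mean_gap k0 x0 k v u" for k u v
    by (simp add: mean_gap_sym)
  show "2 powr - (Pp k + Pm k) * (B - mean_gap k0 x0 k u v) \<le> B - mean_gap k0 x0 (Suc k) u v"
    if "k1 \<le> k" for k u v
    using deficit_Suc_ge[of k0 k x0 B "{}" u v v] bound that assms by simp
  show "2 powr - (Pp k + Pm k) * (B - mean_gap k0 x0 k u v)
      + a_star A / (2 * real CARD('n)) * Pp k * (B - mean_gap k0 x0 k w v)
      \<le> B - mean_gap k0 x0 (Suc k) u v"
    if "k1 \<le> k" "(w, u) \<in> induced_graph A" "w \<noteq> u" for k u v w
  proof -
    let ?Z = "{(u, w)} \<times> {c. fst c}"
    have "a_star A \<le> A $ u $ w"
      using that by (intro a_star_le) (auto simp: induced_graph_def)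
    then have "a_star A / (2 * real CARD('n)) * Pp k * (B - mean_gap k0 x0 k w v)
        \<le> A $ u $ w / (2 * real CARD('n)) * Pp k * (B - mean_gap k0 x0 k w v)"
      using bound that Pp_range[of k]
      by (intro mult_right_mono divide_right_mono) auto
    moreover have "?Z \<inter> quiet = {}" "\<And>z. z \<in> ?Z \<Longrightarrow> dominating_pair z u v = (w, v)"
      using that by (auto simp: quiet_def dominating_pair_def pulled_to_def)
    note deficit_Suc_ge[of k0 k x0 B, OF _ _ this]
    ultimately show ?thesis
      using bound that assms by (simp add: prob_pull_plus)
  qed
qed

text \<open>Here the second node of \<open>(w, u)\<close> receives and is pulled towards
  \<open>w\<close>. Since \<open>A $ w $ u > 0\<close> makes \<open>(u, w)\<close> an arc, values
  travel along the converse.\<close>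

lemma gain_process_minus:
  assumes "k0 \<le> k1" "\<And>a b. mean_gap k0 x0 k1 a b \<le> B"
  shows "gain_process ((induced_graph A)\<inverse>) (\<lambda>k. Pp k + Pm k) Pm (a_star A / (2 * real CARD('n))) k1
    (\<lambda>k u v. B - mean_gap k0 x0 k u v)"
proof -
  interpret plus: gain_process "induced_graph A" "\<lambda>k. Pp k + Pm k" Pp
    "a_star A / (2 * real CARD('n))" k1 "\<lambda>k u v. B - mean_gap k0 x0 k u v"
    by (rule gain_process_plus[OF assms])
  show ?thesis
  proof
    show "0 \<le> Pm k" "Pm k \<le> 1" for k
      using Pm_range[of k] by auto
    show "2 powr - (Pp k + Pm k) * (B - mean_gap k0 x0 k u v)
        + a_star A / (2 * real CARD('n)) * Pm k * (B - mean_gap k0 x0 k w v)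
        \<le> B - mean_gap k0 x0 (Suc k) u v"
      if "k1 \<le> k" "(w, u) \<in> (induced_graph A)\<inverse>" "w \<noteq> u" for k u v w
    proof -
      let ?Z = "{(w, u)} \<times> {c. snd c}"
      have "a_star A \<le> A $ w $ u"
        using that by (intro a_star_le) (auto simp: induced_graph_def)
      then have "a_star A / (2 * real CARD('n)) * Pm k * (B - mean_gap k0 x0 k w v)
          \<le> A $ w $ u / (2 * real CARD('n)) * Pm k * (B - mean_gap k0 x0 k w v)"
        using plus.g_nonneg that Pm_range[of k]
        by (intro mult_right_mono divide_right_mono) auto
      moreover have "?Z \<inter> quiet = {}" "\<And>z. z \<in> ?Z \<Longrightarrow> dominating_pair z u v = (w, v)"
        using that by (auto simp: quiet_def dominating_pair_def pulled_to_def)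
      note deficit_Suc_ge[of k0 k x0 B, OF _ _ this]
      ultimately show ?thesis
        using plus.g_nonneg[OF that(1)] that assms by (simp add: prob_pull_minus)
    qed
  qed (use plus.b plus.p_nonneg plus.g_nonneg plus.g_sym plus.g_stay in auto)
qed

text \<open>The gain along 2 d_* arcs of weight a_*/(2n), after the decay over a block of maximal
  total weight 8 d_* + 2.\<close>

definition block_gain :: real where
  "block_gain = (a_star A / (2 * real CARD('n))) ^ (2 * d_star A) / 2 ^ (8 * d_star A + 2)"

lemma block_gain_bounds: "0 < block_gain" "block_gain < 1"
proof -
  show "0 < block_gain"
    using a_star_bounds card by (simp add: block_gain_def)
  have "block_gain \<le> 1 / 2 ^ (8 * d_star A + 2)"
    unfolding block_gain_def
    using a_star_bounds card by (intro divide_right_mono power_le_one) (auto simp: field_simps)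
  also have "\<dots> < 1"
    by (simp add: field_simps) (rule less_le_trans[of _ 4], auto)
  finally show "block_gain < 1" .
qed

lemma mean_gap_block:
  assumes "k0 \<le> k1" "k1 \<le> m" and B: "\<And>a b. mean_gap k0 x0 k1 a b \<le> B"
    and block: "8 * real (d_star A) \<le> (\<Sum>k\<in>{k1..<m}. Pp k + Pm k)"
      "(\<Sum>k\<in>{k1..<m}. Pp k + Pm k) \<le> 8 * real (d_star A) + 2"
  shows "mean_gap k0 x0 m u v \<le> (1 - block_gain) * B"
proof -
  let ?G = "induced_graph A" and ?b = "a_star A / (2 * real CARD('n))"
  \<comment> \<open>Covers both directions of transport; \<open>F\<close> will be the digraph or its
    converse.\<close>
  have main: ?thesis
    if gain: "gain_process F (\<lambda>k. Pp k + Pm k) r ?b k1 (\<lambda>k u v. B - mean_gap k0 x0 k u v)"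
      and conn: "quasi_strongly_connected F" and diam: "diam F \<le> d_star A"
      and r_sum: "sum r {k1..<m} \<ge> 4 * real (d_star A)" for F r
  proof -
    interpret gain_process F "\<lambda>k. Pp k + Pm k" r ?b k1 "\<lambda>k u v. B - mean_gap k0 x0 k u v"
      by (rule gain)
    obtain c where c: "\<And>v. (c, v) \<in> F\<^sup>*"
      using conn unfolding quasi_strongly_connected_def by (metis rtrancl.rtrancl_refl)
    have dist: "digraph_dist F c v \<le> d_star A" for v
      using digraph_dist_le_diam[OF c] diam by (rule order_trans)
    have B0: "0 \<le> B"
      using B[of c c] by (simp add: mean_gap_self)
    have "1 / 2 ^ (8 * d_star A + 2) = (2::real) powr - real (8 * d_star A + 2)"
      by (simp only: powr_minus powr_realpow zero_less_numeral inverse_eq_divide)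
    also have "\<dots> \<le> 2 powr - (\<Sum>k\<in>{k1..<m}. Pp k + Pm k)"
      using block by (intro powr_mono) auto
    finally have "1 / 2 ^ (8 * d_star A + 2) * ?b ^ (2 * d_star A) * B
        \<le> 2 powr - (\<Sum>k\<in>{k1..<m}. Pp k + Pm k) * ?b ^ (2 * d_star A) * B"
      using B0 b by (intro mult_right_mono) auto
    then have "block_gain * B \<le> 2 powr - (\<Sum>k\<in>{k1..<m}. Pp k + Pm k) * ?b ^ (2 * d_star A) * B"
      by (simp only: block_gain_def times_divide_eq_left mult_1_left)
    \<comment> \<open>The center agrees with itself, so the deficit of \<open>(c, c)\<close> at the
      start of the block is all of \<open>B\<close>.\<close>
    also have "\<dots> = 2 powr - (\<Sum>k\<in>{k1..<m}. Pp k + Pm k) * ?b ^ (2 * d_star A)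
        * (B - mean_gap k0 x0 k1 c c)"
      by (simp add: mean_gap_self)
    also have "\<dots> \<le> B - mean_gap k0 x0 m u v"
      using gain_pair[OF relpow_digraph_dist[OF c] relpow_digraph_dist[OF c] assms(2) dist dist r_sum] .
    finally show ?thesis
      by (simp add: algebra_simps)
  qed
  show ?thesis
  \<comment> \<open>Of a total weight of at least 8 d_*, one of the two kinds carries half.\<close>
  proof (cases "sum Pp {k1..<m} \<ge> 4 * real (d_star A)")
    case True
    show ?thesis
      by (rule main[OF gain_process_plus[OF assms(1) B] center _ True]) (simp add: d_star_def)
  next
    case False
    then have "sum Pm {k1..<m} \<ge> 4 * real (d_star A)"
      using block by (simp add: sum.distrib)
    then show ?thesis
      by (intro main[OF gain_process_minus[OF assms(1) B] anticenter])
        (simp_all add: d_star_def induced_graph_transpose)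
  qed
qed

text \<open>Blocks are cut off from the left, each with weight between 8 d_* and 8 d_* + 2, which is
  possible because a step weighs at most 2.\<close>

lemma mean_gap_blocks:
  assumes "k0 \<le> k1" "k1 \<le> m" "\<And>a b. mean_gap k0 x0 k1 a b \<le> B"
    and "(\<Sum>k\<in>{k1..<m}. Pp k + Pm k) \<ge> real N * (8 * real (d_star A) + 2)"
  shows "mean_gap k0 x0 m u v \<le> (1 - block_gain) ^ N * B"
  using assms
proof (induction N arbitrary: k1 B)
  case 0
  then show ?case using mean_gap_bound by simp
next
  case (Suc N)
  have le2: "Pp k + Pm k \<le> 2" for k
    using Pp_range[of k] Pm_range[of k] by auto
  have "8 * real (d_star A) \<le> real (Suc N) * (8 * real (d_star A) + 2)"
    by (simp add: algebra_simps)
  then obtain l where l: "k1 \<le> l" "l \<le> m" "8 * real (d_star A) \<le> (\<Sum>k\<in>{k1..<l}. Pp k + Pm k)"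
    "(\<Sum>k\<in>{k1..<l}. Pp k + Pm k) \<le> 8 * real (d_star A) + 2"
    using sum_prefix_between[of k1 m "8 * real (d_star A)" "\<lambda>k. Pp k + Pm k" 2] Suc.prems le2
    by auto
  have "(\<Sum>k\<in>{k1..<m}. Pp k + Pm k) = (\<Sum>k\<in>{k1..<l}. Pp k + Pm k) + (\<Sum>k\<in>{l..<m}. Pp k + Pm k)"
    using l by (simp add: sum.atLeastLessThan_concat)
  then have "real N * (8 * real (d_star A) + 2) \<le> (\<Sum>k\<in>{l..<m}. Pp k + Pm k)"
    using Suc.prems l by (simp add: algebra_simps)
  then have "mean_gap k0 x0 m u v \<le> (1 - block_gain) ^ N * ((1 - block_gain) * B)"
    using l Suc.prems by (intro Suc.IH[of l] mean_gap_block[of k0 k1]) auto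
  then show ?case
    by (simp add: mult_ac)
qed

lemma state_start: "state k0 x0 k0 \<omega> = x0"
  by (cases k0) auto

text \<open>Markov's inequality for the sum of all gaps, with \<open>spread x0\<close> as the
  initial bound for every mean gap.\<close>

lemma prob_spread_ge:
  assumes "k0 \<le> m" and x0: "spread x0 > 0" and eps: "\<epsilon> > 0"
    and "(\<Sum>k\<in>{k0..<m}. Pp k + Pm k) \<ge> real N * (8 * real (d_star A) + 2)"
  shows "prob {\<omega> \<in> space M. spread (state k0 x0 m \<omega>) / spread x0 \<ge> \<epsilon>}
    \<le> real CARD('n) ^ 2 * (1 - block_gain) ^ N / \<epsilon>"
proof -
  let ?S = "\<lambda>\<omega>. \<Sum>(u, v)\<in>UNIV. \<bar>state k0 x0 m \<omega> $ u - state k0 x0 m \<omega> $ v\<bar>"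
  have int: "integrable M ?S"
    by (auto simp: split_beta intro!: Bochner_Integration.integrable_sum)
  have "mean_gap k0 x0 m u v \<le> (1 - block_gain) ^ N * spread x0" for u v
    using assms by (intro mean_gap_blocks[of k0 k0])
      (auto simp: mean_gap_def state_start prob_space abs_diff_le_spread)
  then have "(\<Sum>(u, v)\<in>UNIV. mean_gap k0 x0 m u v)
      \<le> (\<Sum>(u :: 'n, v :: 'n)\<in>UNIV. (1 - block_gain) ^ N * spread x0)"
    by (intro sum_mono) auto
  also have "\<dots> = real CARD('n) ^ 2 * (1 - block_gain) ^ N * spread x0"
    by (simp add: split_beta power2_eq_square)
  also have "(\<Sum>(u, v)\<in>UNIV. mean_gap k0 x0 m u v) = expectation ?S"
    by (subst Bochner_Integration.integral_sum) (auto simp: mean_gap_def split_beta)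
  finally have E: "expectation ?S \<le> real CARD('n) ^ 2 * (1 - block_gain) ^ N * spread x0" .
  have "prob {\<omega> \<in> space M. spread (state k0 x0 m \<omega>) / spread x0 \<ge> \<epsilon>}
      \<le> prob {\<omega> \<in> space M. ?S \<omega> \<ge> \<epsilon> * spread x0}"
  proof (rule finite_measure_mono)
    show "{\<omega> \<in> space M. spread (state k0 x0 m \<omega>) / spread x0 \<ge> \<epsilon>} \<subseteq> {\<omega> \<in> space M. ?S \<omega> \<ge> \<epsilon> * spread x0}"
      using x0 order_trans[OF _ spread_le_sum] by (auto simp: field_simps)
    show "{\<omega> \<in> space M. ?S \<omega> \<ge> \<epsilon> * spread x0} \<in> events"
      using borel_measurable_integrable[OF int] by measurable
  qed
  also have "\<dots> \<le> expectation ?S / (\<epsilon> * spread x0)"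
    using int x0 eps by (intro integral_Markov_inequality_measure[where A = "{}"])
      (auto intro!: sum_nonneg AE_I2)
  also have "\<dots> \<le> real CARD('n) ^ 2 * (1 - block_gain) ^ N * spread x0 / (\<epsilon> * spread x0)"
    using E x0 eps by (intro divide_right_mono) auto
  finally show ?thesis
    using x0 by simp
qed

section \<open>Bounds on the computation time\<close>

text \<open>Markov's inequality leaves a factor 1/\<epsilon> and the target probability is
  \<epsilon>, hence the square in the hypothesis on \<open>N\<close>.\<close>

lemma T_com_le_windows:
  assumes eps: "0 < \<epsilon>" and p: "\<And>m. (\<Sum>k\<in>{m..<m + T}. Pp k + Pm k) \<ge> p"
    and q: "real q * p \<ge> real N * (8 * real (d_star A) + 2)"
    and N: "real CARD('n) ^ 2 * (1 - block_gain) ^ N \<le> \<epsilon> ^ 2"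
  shows "T_com M sel Ep Em \<epsilon> \<le> ereal (real (T * q))"
  unfolding T_com_def
proof (rule SUP_least, clarify)
  fix k0 and x0 :: "real^'n" assume x0: "spread x0 > 0"
  let ?K = "{k. k \<ge> k0 \<and> prob {\<omega> \<in> space M. spread (state k0 x0 k \<omega>) / spread x0 \<ge> \<epsilon>} \<le> \<epsilon>}"
  have "prob {\<omega> \<in> space M. spread (state k0 x0 (k0 + T * q) \<omega>) / spread x0 \<ge> \<epsilon>}
      \<le> real CARD('n) ^ 2 * (1 - block_gain) ^ N / \<epsilon>"
    using sum_windows_ge[where f = "\<lambda>k. Pp k + Pm k" and k = k0 and q = q, OF p] q eps x0
    by (intro prob_spread_ge) auto
  also have "\<dots> \<le> \<epsilon> ^ 2 / \<epsilon>"
    using N eps by (intro divide_right_mono) auto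
  finally have "k0 + T * q \<in> ?K"
    using eps by (simp add: power2_eq_square)
  then have "(INF k\<in>?K. ereal (real (k - k0))) \<le> ereal (real (k0 + T * q - k0))"
    by (rule INF_lower)
  then show "(INF k\<in>?K. ereal (real (k - k0))) \<le> ereal (real (T * q))"
    by simp
qed

lemma T_com_le_log:
  assumes p: "p > 0" "\<And>m. (\<Sum>k\<in>{m..<m + T}. Pp k + Pm k) \<ge> p"
  defines "D \<equiv> 8 * real (d_star A) + 2" and "l \<equiv> ln (1 / (1 - block_gain))"
  shows "\<exists>C. \<forall>\<epsilon>. 0 < \<epsilon> \<and> \<epsilon> < 1 \<longrightarrow>
    T_com M sel Ep Em \<epsilon> \<le> ereal (2 * real T * D / (p * l) * ln (1 / \<epsilon>) + C)"
proof (intro exI allI impI)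
  fix \<epsilon> :: real assume eps: "0 < \<epsilon> \<and> \<epsilon> < 1"
  have l: "l > 0"
    using block_gain_bounds by (simp add: l_def)
  have n: "real CARD('n) > 0"
    using card by simp
  \<comment> \<open>\<open>y\<close> solves n^2 (1 - block_gain)^y = \<epsilon>^2. Rounding it up to
    \<open>N\<close>, and then the number of windows up to \<open>q\<close>, adds only a bounded
    amount.\<close>
  define y where "y = (2 * ln (1 / \<epsilon>) + 2 * ln (real CARD('n))) / l"
  have y: "y \<ge> 0"
    using eps l card by (auto simp: y_def intro!: divide_nonneg_pos add_nonneg_nonneg)
  define N where "N = nat \<lceil>y\<rceil>"
  have N: "y \<le> real N" "real N \<le> y + 1"
    using y by (auto simp: N_def)
  define q where "q = nat \<lceil>real N * D / p\<rceil>"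
  have D: "D > 0" by (simp add: D_def)
  have ND: "0 \<le> real N * D / p"
    using D p by auto
  have q: "real N * D / p \<le> real q" "real q \<le> real N * D / p + 1"
    using ND by (auto simp: q_def)
  have "(1 - block_gain) ^ N = exp (- l * real N)"
    using block_gain_bounds by (simp add: l_def ln_div exp_of_nat_mult mult.commute[of _ "real N"])
  also have "\<dots> \<le> exp (- l * y)"
    using N l by simp
  also have "l * y = 2 * ln (1 / \<epsilon>) + 2 * ln (real CARD('n))"
    using l by (simp add: y_def)
  then have "- l * y = ln (\<epsilon> ^ 2 / real CARD('n) ^ 2)"
    using eps n by (simp add: ln_div ln_realpow)
  then have "exp (- l * y) = \<epsilon> ^ 2 / real CARD('n) ^ 2"
    using eps n by simp
  finally have "real CARD('n) ^ 2 * (1 - block_gain) ^ N \<le> \<epsilon> ^ 2"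
    using n by (simp add: field_simps)
  then have "T_com M sel Ep Em \<epsilon> \<le> ereal (real (T * q))"
    using eps p q by (intro T_com_le_windows[where N = N and p = p]) (auto simp: D_def field_simps)
  also have "real (T * q) \<le> real T * ((y + 1) * D / p + 1)"
  proof -
    have "real N * D / p \<le> (y + 1) * D / p"
      using N D p by (intro divide_right_mono mult_right_mono) auto
    with q show ?thesis by (auto intro!: mult_left_mono)
  qed
  also have "\<dots> = 2 * real T * D / (p * l) * ln (1 / \<epsilon>) +
      real T * ((2 * ln (real CARD('n)) / l + 1) * D / p + 1)"
    using l p by (simp add: y_def field_simps)
  finally show "T_com M sel Ep Em \<epsilon> \<le> ereal (2 * real T * D / (p * l) * ln (1 / \<epsilon>) +
      real T * ((2 * ln (real CARD('n)) / l + 1) * D / p + 1))"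
    by simp
qed

text \<open>\<open>theta0_ge\<close> gives 8 d_* + 2 \<le> 2 theta0 for the numerator; by
  \<open>block_loss_ge\<close> the block gain, hence the logarithm in the denominator, is at least
  as large as the stated one.\<close>

lemma rate_le:
  assumes "p > 0"
  shows "2 * real T * (8 * real (d_star A) + 2) / (p * ln (1 / (1 - block_gain)))
    \<le> (4 * real T * theta0 A / p) / ln (1 / (1 - (a_star A / (4 * real CARD('n))) powr theta0 A))"
proof -
  let ?e = "(a_star A / (4 * real CARD('n))) powr theta0 A"
  have theta: "theta0 A \<ge> 4 * real (d_star A) + 1"
    by (rule theta0_ge[OF A_nonneg card center anticenter])
  have e: "0 < ?e" "?e \<le> block_gain"
    using a_star_bounds card theta block_loss_ge[of "a_star A" "real CARD('n)" "d_star A" "theta0 A"]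
    by (auto simp: block_gain_def)
  have l: "0 < ln (1 / (1 - ?e))" "ln (1 / (1 - ?e)) \<le> ln (1 / (1 - block_gain))"
    using e block_gain_bounds by (auto simp: field_simps)
  have "2 * real T * (8 * real (d_star A) + 2) / (p * ln (1 / (1 - block_gain)))
      = (2 * real T * (8 * real (d_star A) + 2) / p) / ln (1 / (1 - block_gain))"
    by simp
  also have "\<dots> \<le> (2 * real T * (2 * theta0 A) / p) / ln (1 / (1 - ?e))"
    using assms theta l by (intro frac_le divide_right_mono mult_left_mono) auto
  finally show ?thesis
    by (simp add: mult.assoc)
qed

lemma T_com_upper:
  assumes p: "p > 0" "\<And>m. (\<Sum>k\<in>{m..<m + T}. Pp k + Pm k) \<ge> p"
  shows "\<exists>C. \<forall>\<epsilon>. 0 < \<epsilon> \<and> \<epsilon> < 1 \<longrightarrow> T_com M sel Ep Em \<epsilon> \<le>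
    ereal ((4 * real T * theta0 A / p)
      / ln (1 / (1 - (a_star A / (4 * real CARD('n))) powr theta0 A)) * ln (1 / \<epsilon>) + C)"
proof -
  obtain C where C: "\<And>\<epsilon>. 0 < \<epsilon> \<and> \<epsilon> < 1 \<Longrightarrow> T_com M sel Ep Em \<epsilon> \<le> ereal
      (2 * real T * (8 * real (d_star A) + 2) / (p * ln (1 / (1 - block_gain))) * ln (1 / \<epsilon>) + C)"
    using T_com_le_log[OF p] by blast
  show ?thesis
  proof (intro exI allI impI)
    fix \<epsilon> :: real assume eps: "0 < \<epsilon> \<and> \<epsilon> < 1"
    show "T_com M sel Ep Em \<epsilon> \<le> ereal ((4 * real T * theta0 A / p)
      / ln (1 / (1 - (a_star A / (4 * real CARD('n))) powr theta0 A)) * ln (1 / \<epsilon>) + C)"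
      using eps rate_le[OF p(1), of T]
      by (intro order_trans[OF C[OF eps]] ereal_less_eq(3)[THEN iffD2] add_right_mono mult_right_mono) auto
  qed
qed

text \<open>On average over \<open>v\<close>, a node is in the selected pair with probability at most \<open>2 / n\<close>.\<close>

lemma ex_node_often_unselected:
  "\<exists>v. \<forall>k. prob (sel k -` {(i, j). i \<noteq> v \<and> j \<noteq> v} \<inter> space M) \<ge> 1 / 3"
proof -
  let ?n = "real CARD('n)"
  \<comment> \<open>The column sums of \<open>A\<close> add up to n, so one of them is at most
    1.\<close>
  have "\<exists>v. (\<Sum>i\<in>UNIV. A $ i $ v) \<le> 1"
  proof (rule ccontr)
    assume "\<not> ?thesis"
    then have "(\<Sum>v\<in>(UNIV :: 'n set). 1) < (\<Sum>v\<in>UNIV. \<Sum>i\<in>UNIV. A $ i $ v)"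
      by (intro sum_strict_mono) (auto simp: not_le)
    also have "\<dots> = (\<Sum>i\<in>UNIV. \<Sum>v\<in>UNIV. A $ i $ v)"
      by (rule sum.swap)
    finally show False
      by (simp add: A_row_sum)
  qed
  then obtain v where v: "(\<Sum>i\<in>UNIV. A $ i $ v) \<le> 1"
    by blast
  show ?thesis
  proof (intro exI allI)
    fix k
    let ?P = "\<lambda>i j. sel k -` {(i, j)} \<inter> space M"
    have P: "prob (?P i j) = A $ i $ j / ?n" for i j
    proof -
      have "?P i j = {\<omega> \<in> space M. sel k \<omega> = (i, j)}"
        by auto
      then show ?thesis
        using sel_prob[of k i j] by simp
    qed
    have ev: "?P i j \<in> events" for i j
      by (intro measurable_sets[OF sel_measurable]) auto
    have "1 - prob (sel k -` {(i, j). i \<noteq> v \<and> j \<noteq> v} \<inter> space M)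
        = prob (space M - sel k -` {(i, j). i \<noteq> v \<and> j \<noteq> v} \<inter> space M)"
      by (rule prob_compl[symmetric]) (auto intro!: measurable_sets[OF sel_measurable])
    also have "space M - sel k -` {(i, j). i \<noteq> v \<and> j \<noteq> v} \<inter> space M = (\<Union>j. ?P v j) \<union> (\<Union>i. ?P i v)"
    proof (rule set_eqI)
      fix \<omega>
      show "\<omega> \<in> space M - sel k -` {(i, j). i \<noteq> v \<and> j \<noteq> v} \<inter> space M
          \<longleftrightarrow> \<omega> \<in> (\<Union>j. ?P v j) \<union> (\<Union>i. ?P i v)"
        by (cases "sel k \<omega>") auto
    qed
    also have "prob \<dots> \<le> prob (\<Union>j. ?P v j) + prob (\<Union>i. ?P i v)"
      by (rule measure_Un_le) (auto intro!: sets.finite_UN ev)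
    also have "\<dots> \<le> (\<Sum>j\<in>UNIV. prob (?P v j)) + (\<Sum>i\<in>UNIV. prob (?P i v))"
      by (intro add_mono finite_measure_subadditive_finite) (use ev in auto)
    also have "\<dots> = (1 + (\<Sum>i\<in>UNIV. A $ i $ v)) / ?n"
      by (simp add: P sum_divide_distrib[symmetric] A_row_sum add_divide_distrib)
    also have "\<dots> \<le> 2 / 3"
      using v card by (intro frac_le) auto
    finally show "prob (sel k -` {(i, j). i \<noteq> v \<and> j \<noteq> v} \<inter> space M) \<ge> 1 / 3"
      by simp
  qed
qed

lemma spread_indicator:
  fixes v :: 'n
  defines "x0 \<equiv> \<chi> i. if i = v then 1 else 0"
  shows "spread x0 > 0"
proof -
  obtain w where "w \<noteq> v"
    using ex_two_others[OF card, of v] by blast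
  then show ?thesis
    using abs_diff_le_spread[of x0 v w] by (simp add: x0_def)
qed

text \<open>Started from the indicator of a rarely selected \<open>v\<close>, the state is unchanged
  at time \<open>k\<close> with probability at least (1/3)^k, which must therefore be at most
  \<epsilon>.\<close>

lemma T_com_lower:
  assumes "0 < \<epsilon>"
  shows "T_com M sel Ep Em \<epsilon> \<ge> ereal (ln (1 / \<epsilon>) / ln 3)"
proof (cases "\<epsilon> \<le> 1")
  case False
  \<comment> \<open>The bound is negative here. Still, an admissible initial state must be
    exhibited, since a supremum over none would be minus infinity.\<close>
  have "ereal 0 \<le> T_com M sel Ep Em \<epsilon>"
    unfolding T_com_def
    by (rule SUP_upper2[of "(0, \<chi> i. if i = undefined then 1 else 0)"])
      (auto intro!: INF_greatest spread_indicator)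
  moreover have "ln (1 / \<epsilon>) / ln 3 \<le> 0"
    using False by (auto simp: divide_le_0_iff)
  ultimately show ?thesis
    by (metis ereal_less_eq(3) order_trans)
next
  case True
  obtain v where v: "\<And>k. prob (sel k -` {(i, j). i \<noteq> v \<and> j \<noteq> v} \<inter> space M) \<ge> 1 / 3"
    using ex_node_often_unselected by blast
  define x0 :: "real^'n" where "x0 = (\<chi> i. if i = v then 1 else 0)"
  have x0: "spread x0 > 0"
    unfolding x0_def by (rule spread_indicator)
  let ?S = "{(i, j). i \<noteq> v \<and> j \<noteq> v}"
  have "ereal (ln (1 / \<epsilon>) / ln 3) \<le> ereal (real (k - 0))"
    if k: "prob {\<omega> \<in> space M. spread (state 0 x0 k \<omega>) / spread x0 \<ge> \<epsilon>} \<le> \<epsilon>" for k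
  proof -
    \<comment> \<open>All nodes other than \<open>v\<close> hold the same value, so averaging among
      them changes nothing.\<close>
    have frozen: "state 0 x0 k \<omega> = x0" if "\<forall>l<k. sel l \<omega> \<in> ?S" for \<omega>
      using that
      by (induction k) (auto simp: gossip_step_def x0_def vec_eq_iff)
    have "(1 / 3) ^ k \<le> prob {\<omega> \<in> space M. spread (state 0 x0 k \<omega>) / spread x0 \<ge> \<epsilon>}"
    \<comment> \<open>The product rule needs a nonempty set of times; at time 0 the ratio is
      1.\<close>
    proof (cases "k = 0")
      case True
      then show ?thesis
        using \<open>\<epsilon> \<le> 1\<close> x0 by (simp add: prob_space)
    next
      case False
      have "(1 / 3) ^ k = (\<Prod>l<k. 1 / 3 :: real)"
        by simp
      also have "\<dots> \<le> (\<Prod>l<k. prob (sel l -` ?S \<inter> space M))"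
        using v by (intro prod_mono) auto
      also have "\<dots> = prob (\<Inter>l\<in>{..<k}. sel l -` ?S \<inter> space M)"
        using False by (intro indep_varsD[OF sel_indep, symmetric]) auto
      also have "\<dots> \<le> prob {\<omega> \<in> space M. spread (state 0 x0 k \<omega>) / spread x0 \<ge> \<epsilon>}"
      proof (rule finite_measure_mono)
        show "(\<Inter>l\<in>{..<k}. sel l -` ?S \<inter> space M)
            \<subseteq> {\<omega> \<in> space M. spread (state 0 x0 k \<omega>) / spread x0 \<ge> \<epsilon>}"
          using False frozen x0 True by (auto 0 3)
        show "{\<omega> \<in> space M. spread (state 0 x0 k \<omega>) / spread x0 \<ge> \<epsilon>} \<in> events"
          by measurable
      qed
      finally show ?thesis .
    qed
    then have "(1 / 3) ^ k \<le> \<epsilon>"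
      using k by simp
    then have "1 / \<epsilon> \<le> 3 ^ k"
      using assms by (simp add: field_simps)
    then have "ln (1 / \<epsilon>) \<le> real k * ln 3"
      using assms ln_le_cancel_iff[of "1 / \<epsilon>" "3 ^ k"] by (simp add: ln_realpow)
    then show ?thesis
      by (simp add: field_simps)
  qed
  then have "ereal (ln (1 / \<epsilon>) / ln 3) \<le> (INF k\<in>{k. k \<ge> 0 \<and>
      prob {\<omega> \<in> space M. spread (state 0 x0 k \<omega>) / spread x0 \<ge> \<epsilon>} \<le> \<epsilon>}. ereal (real (k - 0)))"
    by (intro INF_greatest) auto
  then show ?thesis
    unfolding T_com_def using x0 by (intro SUP_upper2[of "(0, x0)"]) auto
qed

text \<open>While nobody communicates the state does not change, so a finite computation time forces
  the expected amount of communication in every window of that length to stay away from \<open>0\<close>.\<close>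

lemma communication_if_T_com_finite:
  assumes fin: "T_com M sel Ep Em \<epsilon> < \<infinity>" and eps: "0 < \<epsilon>" "\<epsilon> < 1"
  shows "\<exists>T\<ge>1. \<forall>m. (\<Sum>k\<in>{m..<m + T}. Pp k + Pm k) \<ge> 1 - \<epsilon>"
proof -
  obtain t where "T_com M sel Ep Em \<epsilon> < ereal (real t)"
    using less_PInf_Ex_of_nat[of "T_com M sel Ep Em \<epsilon>"] fin by auto
  \<comment> \<open>The successor ensures that \<open>T\<close> is at least 1.\<close>
  define T where "T = Suc t"
  have T: "T_com M sel Ep Em \<epsilon> < ereal (real T)"
    using \<open>T_com M sel Ep Em \<epsilon> < ereal (real t)\<close> by (rule less_trans) (simp add: T_def)
  have "(\<Sum>k\<in>{m..<m + T}. Pp k + Pm k) \<ge> 1 - \<epsilon>" for m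
  proof -
    define x0 :: "real^'n" where "x0 = (\<chi> i. if i = undefined then 1 else 0)"
    have x0: "spread x0 > 0"
      unfolding x0_def by (rule spread_indicator)
    have "(INF k\<in>{k. k \<ge> m \<and> prob {\<omega> \<in> space M. spread (state m x0 k \<omega>) / spread x0 \<ge> \<epsilon>} \<le> \<epsilon>}.
        ereal (real (k - m))) \<le> T_com M sel Ep Em \<epsilon>"
      unfolding T_com_def using x0 by (intro SUP_upper2[of "(m, x0)"]) auto
    with T have "(INF k\<in>{k. k \<ge> m \<and> prob {\<omega> \<in> space M. spread (state m x0 k \<omega>) / spread x0 \<ge> \<epsilon>} \<le> \<epsilon>}.
        ereal (real (k - m))) < ereal (real T)"
      by (rule le_less_trans[rotated])
    then obtain k where k: "k \<ge> m" "k < m + T"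
      "prob {\<omega> \<in> space M. spread (state m x0 k \<omega>) / spread x0 \<ge> \<epsilon>} \<le> \<epsilon>"
      by (auto simp: INF_less_iff)
    let ?H = "{\<omega> \<in> space M. spread (state m x0 k \<omega>) / spread x0 \<ge> \<epsilon>}"
    have H: "?H \<in> events"
      by measurable
    have frozen: "state m x0 k \<omega> = x0" if "\<forall>l\<in>{m..<k}. \<omega> \<notin> Ep l \<and> \<omega> \<notin> Em l" for \<omega>
      using that by (induction k) (auto simp: gossip_step_def vec_eq_iff not_less)
    \<comment> \<open>With probability at least 1 - \<epsilon> the spread has dropped, so someone
      has received a value since time \<open>m\<close>; union bounds turn this into a sum.\<close>
    have "1 - \<epsilon> \<le> prob (space M - ?H)"
      using k prob_compl[OF H] by simp
    also have "\<dots> \<le> prob (\<Union>l\<in>{m..<k}. Ep l \<union> Em l)"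
    proof (rule finite_measure_mono)
      show "space M - ?H \<subseteq> (\<Union>l\<in>{m..<k}. Ep l \<union> Em l)"
      proof
        fix \<omega> assume \<omega>: "\<omega> \<in> space M - ?H"
        show "\<omega> \<in> (\<Union>l\<in>{m..<k}. Ep l \<union> Em l)"
        proof (rule ccontr)
          assume "\<not> ?thesis"
          then have "state m x0 k \<omega> = x0"
            by (intro frozen) auto
          then show False
            using \<omega> x0 eps by auto
        qed
      qed
      show "(\<Union>l\<in>{m..<k}. Ep l \<union> Em l) \<in> events"
        using Ep_event Em_event by auto
    qed
    also have "\<dots> \<le> (\<Sum>l\<in>{m..<k}. prob (Ep l \<union> Em l))"
      using Ep_event Em_event by (intro finite_measure_subadditive_finite) auto
    also have "\<dots> \<le> (\<Sum>l\<in>{m..<k}. Pp l + Pm l)"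
    proof (rule sum_mono)
      fix l
      show "prob (Ep l \<union> Em l) \<le> Pp l + Pm l"
        using measure_Un_le[OF Ep_event Em_event, of l l] by (simp add: Ep_prob Em_prob)
    qed
    also have "\<dots> \<le> (\<Sum>l\<in>{m..<m + T}. Pp l + Pm l)"
      using k Pp_range Pm_range by (intro sum_mono2) auto
    finally show ?thesis .
  qed
  then show ?thesis
    by (intro exI[of _ T]) (simp add: T_def)
qed

text \<open>A finite limit superior keeps the quotient eventually below infinity, and for \<epsilon>
  < 1 its divisor is a positive real.\<close>

lemma consensus_imp_T_com_finite:
  assumes "global_as_eps_consensus M sel Ep Em"
  shows "\<exists>\<epsilon>. 0 < \<epsilon> \<and> \<epsilon> < 1 \<and> T_com M sel Ep Em \<epsilon> < \<infinity>"
proof -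
  obtain c where "Limsup (at_right 0) (\<lambda>\<epsilon>. T_com M sel Ep Em \<epsilon> / ereal (ln (1 / \<epsilon>))) = ereal c"
    using assms by (auto simp: global_as_eps_consensus_def exact_order_at_0_def)
  then have "\<forall>\<^sub>F \<epsilon> in at_right 0. T_com M sel Ep Em \<epsilon> / ereal (ln (1 / \<epsilon>)) < \<infinity>"
    by (intro Limsup_lessD) simp
  moreover have "\<forall>\<^sub>F \<epsilon> in at_right (0::real). \<epsilon> \<in> {0<..<1}"
    by (rule eventually_at_right_real) simp
  ultimately have "\<forall>\<^sub>F \<epsilon> in at_right 0. T_com M sel Ep Em \<epsilon> / ereal (ln (1 / \<epsilon>)) < \<infinity> \<and> \<epsilon> \<in> {0<..<1}"
    by (rule eventually_conj)
  then obtain \<epsilon> where "T_com M sel Ep Em \<epsilon> / ereal (ln (1 / \<epsilon>)) < \<infinity>" "\<epsilon> \<in> {0<..<1}"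
    using eventually_happens'[OF trivial_limit_at_right_real] by blast
  then show ?thesis
    by (cases "T_com M sel Ep Em \<epsilon>") (auto intro!: exI[of _ \<epsilon>])
qed

text \<open>Together with \<open>T_com_lower\<close> the bound traps the quotient between two reals,
  the lower one positive, so the limit superior is real and nonzero.\<close>

lemma consensus_if_log_bound:
  assumes "\<And>\<epsilon>. 0 < \<epsilon> \<and> \<epsilon> < 1 \<Longrightarrow> T_com M sel Ep Em \<epsilon> \<le> ereal (K * ln (1 / \<epsilon>) + C)"
  shows "global_as_eps_consensus M sel Ep Em"
proof -
  let ?f = "\<lambda>\<epsilon>. T_com M sel Ep Em \<epsilon> / ereal (ln (1 / \<epsilon>))"
  let ?L = "Limsup (at_right 0) ?f"
  \<comment> \<open>Below \<open>exp (- 1)\<close> the logarithm is at least 1 and absorbs the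
    constant \<open>C\<close>.\<close>
  have small: "\<forall>\<^sub>F \<epsilon> in at_right (0::real). \<epsilon> \<in> {0<..<exp (- 1)}"
    by (rule eventually_at_right_real) simp
  have bounds: "ereal (1 / ln 3) \<le> ?f \<epsilon> \<and> ?f \<epsilon> \<le> ereal (K + \<bar>C\<bar>)" if "\<epsilon> \<in> {0<..<exp (- 1)}" for \<epsilon>
  proof -
    have eps: "0 < \<epsilon>" "\<epsilon> < 1"
      using that by (auto intro: less_trans[of _ "exp (-1)"])
    have "ln \<epsilon> < ln (exp (- 1))"
      using that by (subst ln_less_cancel_iff) auto
    then have ln: "ln (1 / \<epsilon>) \<ge> 1"
      using eps by (simp add: ln_div)
    have "\<bar>C\<bar> * 1 \<le> \<bar>C\<bar> * ln (1 / \<epsilon>)"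
      using ln by (intro mult_left_mono) auto
    then have "K * ln (1 / \<epsilon>) + C \<le> (K + \<bar>C\<bar>) * ln (1 / \<epsilon>)"
      by (simp add: distrib_right)
    then have "T_com M sel Ep Em \<epsilon> \<le> ereal ((K + \<bar>C\<bar>) * ln (1 / \<epsilon>))"
      using order_trans[OF assms] eps by (metis ereal_less_eq(3))
    then show ?thesis
      using T_com_lower[OF eps(1)] ln
      by (auto simp: ereal_le_divide_pos ereal_divide_le_pos mult.commute)
  qed
  have "ereal (1 / ln 3) \<le> ?L"
    by (intro le_Limsup eventually_mono[OF small]) (auto simp: bounds)
  moreover have "?L \<le> ereal (K + \<bar>C\<bar>)"
    by (intro Limsup_bounded eventually_mono[OF small]) (auto simp: bounds)
  ultimately obtain c where c: "?L = ereal c" "1 / ln 3 \<le> c"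
    by (cases ?L) auto
  moreover have "(0::real) < 1 / ln 3"
    by simp
  ultimately have "c \<noteq> 0"
    by linarith
  with c show ?thesis
    unfolding global_as_eps_consensus_def exact_order_at_0_def by blast
qed

end

theorem theorem5:
  fixes M :: "'w measure"
    and A :: "real^'n::finite^'n"
    and Pp Pm :: "nat \<Rightarrow> real"
    and sel :: "nat \<Rightarrow> 'w \<Rightarrow> 'n \<times> 'n"
    and Ep Em :: "nat \<Rightarrow> 'w set"
  assumes "gossip_network M A Pp Pm sel Ep Em"
    and "CARD('n) \<ge> 3"
    and "\<forall>k. prob_space.indep_event M (Ep k) (Em k)"
    and "quasi_strongly_connected (induced_graph A)"
    and "quasi_strongly_connected ((induced_graph A)\<inverse>)"
  shows "(global_as_eps_consensus M sel Ep Em \<longleftrightarrow>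
           (\<exists>p::real. \<exists>T::nat. p > 0 \<and> T \<ge> 1 \<and> (\<forall>m. (\<Sum>k=m..m+T-1. Pp k + Pm k) \<ge> p)))
       \<and> (\<forall>(p::real) (T::nat).
           p > 0 \<and> T \<ge> 1 \<and> (\<forall>m. (\<Sum>k=m..m+T-1. Pp k + Pm k) \<ge> p) \<longrightarrow>
           (\<exists>h :: real \<Rightarrow> real. h \<in> O[at_right 0](\<lambda>_. 1) \<and>
             (\<forall>\<^sub>F \<epsilon> in at_right 0.
               T_com M sel Ep Em \<epsilon> \<le>
                 ereal ((4 * real T * theta0 A / p)
                   / ln (1 / (1 - (a_star A / (4 * real CARD('n))) powr theta0 A))
                   * ln (1 / \<epsilon>) + h \<epsilon>))))"
proof -
  interpret gossip_network M A Pp Pm sel Ep Em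
    by fact
  interpret connected_gossip_network M A Pp Pm sel Ep Em
    by standard fact+
  let ?K = "\<lambda>p T. (4 * real T * theta0 A / p)
    / ln (1 / (1 - (a_star A / (4 * real CARD('n))) powr theta0 A))"
  \<comment> \<open>For \<open>T = 0\<close> and \<open>m = 0\<close> truncated subtraction would
    leave the index 0 in the left interval.\<close>
  have window: "{m..m + T - 1} = {m..<m + T}" if "T \<ge> 1" for m T :: nat
    using that by auto
  have upper: "\<exists>C. \<forall>\<epsilon>. 0 < \<epsilon> \<and> \<epsilon> < 1 \<longrightarrow> T_com M sel Ep Em \<epsilon> \<le> ereal (?K p T * ln (1 / \<epsilon>) + C)"
    if "p > 0" "T \<ge> 1" "\<forall>m. (\<Sum>k=m..m+T-1. Pp k + Pm k) \<ge> p" for p T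
    using that(3) by (intro T_com_upper that(1)) (simp only: window[OF that(2)])
  have "\<exists>p T. p > 0 \<and> T \<ge> 1 \<and> (\<forall>m. (\<Sum>k=m..m+T-1. Pp k + Pm k) \<ge> p)"
    if consensus: "global_as_eps_consensus M sel Ep Em"
  proof -
    \<comment> \<open>Any \<epsilon> < 1 with finite computation time provides
      \<open>1 - \<epsilon>\<close> as the constant \<open>p\<close>.\<close>
    obtain \<epsilon> T where "\<epsilon> < 1" "T \<ge> 1" "\<And>m. (\<Sum>k\<in>{m..<m + T}. Pp k + Pm k) \<ge> 1 - \<epsilon>"
      using consensus_imp_T_com_finite[OF consensus] communication_if_T_com_finite by metis
    then show ?thesis
      by (intro exI[of _ "1 - \<epsilon>"] exI[of _ T]) (simp only: window, simp)
  qed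
  moreover have "global_as_eps_consensus M sel Ep Em"
    if windows: "\<exists>p T. p > 0 \<and> T \<ge> 1 \<and> (\<forall>m. (\<Sum>k=m..m+T-1. Pp k + Pm k) \<ge> p)"
  proof -
    obtain p T where "p > 0" "T \<ge> 1" "\<forall>m. (\<Sum>k=m..m+T-1. Pp k + Pm k) \<ge> p"
      using windows by blast
    from upper[OF this] obtain C where
      "\<And>\<epsilon>. 0 < \<epsilon> \<and> \<epsilon> < 1 \<Longrightarrow> T_com M sel Ep Em \<epsilon> \<le> ereal (?K p T * ln (1 / \<epsilon>) + C)"
      by blast
    then show ?thesis
      by (rule consensus_if_log_bound)
  qed
  moreover have "\<exists>h. h \<in> O[at_right 0](\<lambda>_. 1 :: real) \<and>
      (\<forall>\<^sub>F \<epsilon> in at_right 0. T_com M sel Ep Em \<epsilon> \<le> ereal (?K p T * ln (1 / \<epsilon>) + h \<epsilon>))"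
    if windows: "p > 0 \<and> T \<ge> 1 \<and> (\<forall>m. (\<Sum>k=m..m+T-1. Pp k + Pm k) \<ge> p)" for p T
  proof -
    obtain C where C: "\<And>\<epsilon>. 0 < \<epsilon> \<and> \<epsilon> < 1 \<Longrightarrow> T_com M sel Ep Em \<epsilon> \<le> ereal (?K p T * ln (1 / \<epsilon>) + C)"
      using upper windows by blast
    have "\<forall>\<^sub>F \<epsilon> in at_right (0::real). \<epsilon> \<in> {0<..<1}"
      by (rule eventually_at_right_real) simp
    then have "\<forall>\<^sub>F \<epsilon> in at_right 0. T_com M sel Ep Em \<epsilon> \<le> ereal (?K p T * ln (1 / \<epsilon>) + C)"
      by (rule eventually_mono) (use C in auto)
    then show ?thesis
      by (intro exI[of _ "\<lambda>_. C"]) auto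
  qed
  ultimately show ?thesis
    by blast
qed

end
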